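(* Let $M$ be a $G_X$-invariant surface of the Heisenberg group $(\mathbb{H}_3,g)$, and let $\tilde\gamma(u)=(\xi_1(u),\xi_2(u))$ be its profile curve in the regular part of the orbit space $(\mathcal{B}=\mathbb{H}_3/G_X,\tilde g)$, which is parametrized by the invariant functions $\xi_1$ and $\xi_2$. With respect to the local parametrization $\psi(u,v)=\phi_v(\gamma(u))$ we have: (i) If $G_X=G_1$ (generated by $X_1$), then the orbit space is $\mathcal{B}=\mathbb{R}^2$ and a loxodrome can be parametrized by $\psi(u,v(u))$, where $$v(u)=\int_{u_0}^u\frac{\xi_1(t)\sqrt{1-\xi_1'(t)^2}\pm\cot\vartheta_0}{\sqrt{1+\xi_1(t)^2}}\,dt$$ and $\psi(u,v)=\left(v,\xi_1(u),\frac{\xi_1(u)}{2}v-\xi_2(u)\right)$. (ii) If $G_X=G_3$ (generated by $X_3$), then the orbit space is $\mathcal{B}=\mathbb{R}^2$ and a loxodrome can be parametrized by $\psi(u,v(u))$, where $$v(u)=-\frac{\xi_1(u)}{2}\int_{u_0}^u\sqrt{1-\xi_1'(t)^2}\,dt+\int_{u_0}^u\xi_1(t)\sqrt{1-\xi_1'(t)^2}\,dt\pm\cot\vartheta_0\,(u-u_0)$$ and $\psi(u,v)=(\xi_1(u),\xi_2(u),v)$. These curves are general helices with axis $X_3$. (iii) If $G_X=G_{43}$ (generated by $X_4+aX_3$, $a\in\mathbb{R}$), then the orbit space is $\mathcal{B}=\{(\xi_1,\xi_2)\in\mathbb{R}^2:\xi_1\ge0\}$ and a loxodrome can be parametrized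 by $\psi(u,v(u))$, where $$v(u)=\int_{u_0}^u\frac{(\xi_1(t)^2-2a)\sqrt{1-\xi_1'(t)^2}\pm2\cot\vartheta_0\,\xi_1(t)}{\xi_1(t)\sqrt{4\xi_1(t)^2+(\xi_1(t)^2-2a)^2}}\,dt$$ and $\psi(u,v)=(\xi_1(u)\cos v,\xi_1(u)\sin v,\xi_2(u)+av)$.
   Context: The Heisenberg group $\mathbb{H}_3$ is $\mathbb{R}^3$ with coordinates $(x,y,z)$ and the left-invariant metric $g=dx^2+dy^2+\left(\frac12y\,dx-\frac12x\,dy+dz\right)^2$. Killing fields: $X_1=\partial_x+\frac y2\partial_z$, $X_2=\partial_y-\frac x2\partial_z$, $X_3=\partial_z$, $X_4=-y\partial_x+x\partial_y$. For a Killing field $X$, $G_X$ is the one-parameter group of isometries it generates, with flow $\phi_v$. A $G_X$-invariant surface is an immersed surface in the regular part (union of principal orbits) invariant under $G_X$. Its profile curve is its projection to the orbit space $\mathcal{B}$, parametrized by arc length with respect to the quotient metric $\tilde g$ (the metric making the projection a Riemannian submersion on the regular part). The surface is locally $\psi(u,v)=\phi_v(\gamma(u))$, with $\gamma$ a lift of the profile curve. The invariant functions and quotient metrics used are: Case (i): $\xi_1=y$, $\xi_2=\frac{xy}{2}-z$, $\tilde g=d\xi_1^2+\frac{d\xi_2^2}{1+\xi_1^2}$. Case (ii): $\xi_1=x$, $\xi_2=y$, $\tilde g=d\xi_1^2+d\xi_2^2$. Case (iii), in cylindrical coordinates $(r,\theta,z)$: $\xi_1=r$, $\xi_2=z-a\theta$,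 and on the regular part $\{\xi_1>0\}$, $\tilde g=d\xi_1^2+\frac{4\xi_1^2\,d\xi_2^2}{4\xi_1^2+(\xi_1^2-2a)^2}$. A loxodrome on $M$ is a curve on $M$ making a constant angle $\vartheta_0\in[0,\pi)$ with $X$: parametrized by arc length, $g(\alpha',X)=\|X\|\cos\vartheta_0$. Throughout, loxodromes are assumed not to be orbits, i.e. $\vartheta_0\neq0$. A general helix with axis $X_3$ is a curve making a constant angle with $X_3$.
   Formalization: The root √(1−ξ1'²) carries the sign of ξ2'; in (ii) v(u) has the extra term −ξ2(u0)(ξ1(u)−ξ1(u0))/2; in (iii) the orbit space is that of the action lifted to cylindrical coordinates with real θ (the literal quotient only for a=0). The printed claims fail without these. *)

theory Defs
  imports "HOL-Analysis.Analysis"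
begin

section \<open>The Heisenberg group and its Killing fields\<close>

type_synonym pt = "real \<times> real \<times> real"

text \<open>The metric \<open>dx\<^sup>2 + dy\<^sup>2 + (y/2 dx - x/2 dy + dz)\<^sup>2\<close> at the point \<open>p\<close>.\<close>

definition heis :: "pt \<Rightarrow> pt \<Rightarrow> pt \<Rightarrow> real" where
  "heis = (\<lambda>(x, y, z) (a, b, c) (a', b', c').
     a * a' + b * b' + (y / 2 * a - x / 2 * b + c) * (y / 2 * a' - x / 2 * b' + c'))"

definition heis_norm :: "pt \<Rightarrow> pt \<Rightarrow> real" where
  "heis_norm p w = sqrt (heis p w w)"

definition X1 :: "pt \<Rightarrow> pt" where "X1 = (\<lambda>(x, y, z). (1, 0, y / 2))"
definition X3 :: "pt \<Rightarrow> pt" where "X3 = (\<lambda>(x, y, z). (0, 0, 1))"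
definition X4 :: "pt \<Rightarrow> pt" where "X4 = (\<lambda>(x, y, z). (- y, x, 0))"
definition X43 :: "real \<Rightarrow> pt \<Rightarrow> pt" where "X43 a = (\<lambda>p. X4 p + a *\<^sub>R X3 p)"

definition is_flow :: "(pt \<Rightarrow> pt) \<Rightarrow> (real \<Rightarrow> pt \<Rightarrow> pt) \<Rightarrow> bool" where
  "is_flow X \<phi> \<longleftrightarrow> (\<forall>p. \<phi> 0 p = p \<and>
     (\<forall>v. ((\<lambda>w. \<phi> w p) has_vector_derivative X (\<phi> v p)) (at v)))"

definition flow :: "(pt \<Rightarrow> pt) \<Rightarrow> real \<Rightarrow> pt \<Rightarrow> pt" where
  "flow X = (THE \<phi>. is_flow X \<phi>)"


section \<open>Orbit spaces, invariant functions and quotient metrics\<close>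

text \<open>
  The invariant functions may live on a coordinate domain \<open>C\<close> over the Heisenberg group, with
  coordinate map \<open>q\<close>, instead of on the group itself: in case (iii) the function \<open>z - a \<theta>\<close> is a
  function of cylindrical coordinates with a real angle \<open>\<theta>\<close>, and for \<open>a \<noteq> 0\<close> it does not
  descend to a function of \<open>(x, y, z)\<close>.  So \<open>act\<close> is the action of the one-parameter group in
  these coordinates, and \<open>\<Xi>\<close> identifies its orbit space (with the quotient topology) with \<open>B\<close>.
  In cases (i) and (ii) one has \<open>q = id\<close> and \<open>C = UNIV\<close>.\<close>

definition orbit_space ::
  "(pt \<Rightarrow> pt) \<Rightarrow> (pt \<Rightarrow> pt) \<Rightarrow> pt set \<Rightarrow> (real \<Rightarrow> pt \<Rightarrow> pt) \<Rightarrow> (pt \<Rightarrow> real \<times> real) \<Rightarrow> (real \<times> real) set \<Rightarrow> bool" where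
  "orbit_space X q C act \<Xi> B \<longleftrightarrow>
     q ` C = UNIV \<and>
     (\<forall>v. \<forall>p\<in>C. act v p \<in> C \<and> q (act v p) = flow X v (q p)) \<and>
     quotient_map (top_of_set C) (top_of_set B) \<Xi> \<and>
     (\<forall>p\<in>C. \<forall>p'\<in>C. \<Xi> p = \<Xi> p' \<longleftrightarrow> (\<exists>v. p' = act v p))"

definition inv_i :: "pt \<Rightarrow> real \<times> real" where "inv_i = (\<lambda>(x, y, z). (y, x * y / 2 - z))"
definition inv_ii :: "pt \<Rightarrow> real \<times> real" where "inv_ii = (\<lambda>(x, y, z). (x, y))"
definition inv_iii :: "real \<Rightarrow> pt \<Rightarrow> real \<times> real" where "inv_iii a = (\<lambda>(r, \<theta>, z). (r, z - a * \<theta>))"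

definition cyl :: "pt \<Rightarrow> pt" where "cyl = (\<lambda>(r, \<theta>, z). (r * cos \<theta>, r * sin \<theta>, z))"

definition cyl_dom :: "pt set" where "cyl_dom = {(r, \<theta>, z). 0 \<le> r}"

definition cyl_act :: "real \<Rightarrow> real \<Rightarrow> pt \<Rightarrow> pt" where
  "cyl_act a v = (\<lambda>(r, \<theta>, z). (r, \<theta> + v, z + a * v))"

definition half_plane :: "(real \<times> real) set" where "half_plane = {(s, t). 0 \<le> s}"

definition open_half_plane :: "(real \<times> real) set" where "open_half_plane = {(s, t). 0 < s}"

text \<open>Squared lengths of tangent vectors in the three quotient metrics.\<close>

definition quot_i :: "real \<times> real \<Rightarrow> real \<times> real \<Rightarrow> real" where
  "quot_i = (\<lambda>(s, t) (ds, dt). ds\<^sup>2 + dt\<^sup>2 / (1 + s\<^sup>2))"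

definition quot_ii :: "real \<times> real \<Rightarrow> real \<times> real \<Rightarrow> real" where
  "quot_ii = (\<lambda>(s, t) (ds, dt). ds\<^sup>2 + dt\<^sup>2)"

definition quot_iii :: "real \<Rightarrow> real \<times> real \<Rightarrow> real \<times> real \<Rightarrow> real" where
  "quot_iii a = (\<lambda>(s, t) (ds, dt). ds\<^sup>2 + 4 * s\<^sup>2 * dt\<^sup>2 / (4 * s\<^sup>2 + (s\<^sup>2 - 2 * a)\<^sup>2))"

text \<open>
  These are the metrics that make the projections Riemannian submersions: a vector \<open>w\<close>
  orthogonal to the Killing field has the same length as its projection.  In (iii) the vector
  \<open>w\<close> is written in cylindrical coordinates.\<close>

lemma submersion_i:
  assumes "heis (x, y, z) (a, b, c) (X1 (x, y, z)) = 0"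
  shows "(inv_i has_derivative (\<lambda>(a, b, c). (b, (a * y + x * b) / 2 - c))) (at (x, y, z))"
    and "quot_i (inv_i (x, y, z)) (b, (a * y + x * b) / 2 - c) = heis (x, y, z) (a, b, c) (a, b, c)"
proof -
  show "(inv_i has_derivative (\<lambda>(a, b, c). (b, (a * y + x * b) / 2 - c))) (at (x, y, z))"
    unfolding inv_i_def case_prod_beta
    by (auto intro!: derivative_eq_intros simp: fun_eq_iff field_simps)
  define w where "w = y / 2 * a - x / 2 * b + c"
  have a: "a = - (y * w)"
    using assms by (simp add: heis_def X1_def w_def algebra_simps)
  have d: "(a * y + x * b) / 2 - c = a * y - w"
    by (simp add: w_def field_simps)
  have "quot_i (inv_i (x, y, z)) (b, (a * y + x * b) / 2 - c) = b\<^sup>2 + (a * y - w)\<^sup>2 / (1 + y\<^sup>2)"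
    by (simp only: d) (simp add: quot_i_def inv_i_def)
  also have "(a * y - w)\<^sup>2 = ((1 + y\<^sup>2) * w)\<^sup>2"
    unfolding a by algebra
  also have "((1 + y\<^sup>2) * w)\<^sup>2 / (1 + y\<^sup>2) = (1 + y\<^sup>2) * w\<^sup>2"
    by (simp add: power2_eq_square add_nonneg_eq_0_iff)
  also have "b\<^sup>2 + (1 + y\<^sup>2) * w\<^sup>2 = a * a + b * b + w * w"
    unfolding a by algebra
  finally show "quot_i (inv_i (x, y, z)) (b, (a * y + x * b) / 2 - c) = heis (x, y, z) (a, b, c) (a, b, c)"
    by (simp add: heis_def w_def)
qed

lemma submersion_ii:
  assumes "heis (x, y, z) (a, b, c) (X3 (x, y, z)) = 0"
  shows "(inv_ii has_derivative (\<lambda>(a, b, c). (a, b))) (at (x, y, z))"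
    and "quot_ii (inv_ii (x, y, z)) (a, b) = heis (x, y, z) (a, b, c) (a, b, c)"
proof -
  show "(inv_ii has_derivative (\<lambda>(a, b, c). (a, b))) (at (x, y, z))"
    unfolding inv_ii_def case_prod_beta
    by (auto intro!: derivative_eq_intros)
  show "quot_ii (inv_ii (x, y, z)) (a, b) = heis (x, y, z) (a, b, c) (a, b, c)"
    using assms by (simp add: heis_def X3_def quot_ii_def inv_ii_def power2_eq_square)
qed

lemma submersion_iii:
  fixes a r \<theta> z dr d\<theta> dz :: real
  defines "w \<equiv> (cos \<theta> * dr - r * sin \<theta> * d\<theta>, sin \<theta> * dr + r * cos \<theta> * d\<theta>, dz)"
  assumes "0 < r" and "heis (cyl (r, \<theta>, z)) w (X43 a (cyl (r, \<theta>, z))) = 0"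
  shows "quot_iii a (inv_iii a (r, \<theta>, z)) (dr, dz - a * d\<theta>) = heis (cyl (r, \<theta>, z)) w w"
proof -
  define C S where "C = cos \<theta>" and "S = sin \<theta>"
  note CS = C_def[symmetric] S_def[symmetric]
  have cs: "C * C + S * S = 1"
    using sin_cos_squared_add[of \<theta>] by (simp add: C_def S_def power2_eq_square)
  define m where "m = dz - r\<^sup>2 / 2 * d\<theta>"
  define k where "k = a - r\<^sup>2 / 2"
  have len: "(C * dr - r * S * d\<theta>) * (C * dr - r * S * d\<theta>)
      + (S * dr + r * C * d\<theta>) * (S * dr + r * C * d\<theta>)
      = (C * C + S * S) * (dr\<^sup>2 + r\<^sup>2 * d\<theta>\<^sup>2)"
    by (simp add: algebra_simps power2_eq_square)
  have "r * S / 2 * (C * dr - r * S * d\<theta>)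
      - r * C / 2 * (S * dr + r * C * d\<theta>) + dz
      = dz - (C * C + S * S) * (r\<^sup>2 / 2 * d\<theta>)"
    by (simp add: field_simps power2_eq_square)
  then have om: "r * S / 2 * (C * dr - r * S * d\<theta>)
      - r * C / 2 * (S * dr + r * C * d\<theta>) + dz = m"
    unfolding cs m_def by simp
  have g: "heis (cyl (r, \<theta>, z)) w w = dr\<^sup>2 + r\<^sup>2 * d\<theta>\<^sup>2 + m\<^sup>2"
    unfolding heis_def cyl_def w_def split CS om len cs by (simp add: power2_eq_square)
  have "r * S / 2 * - (r * S) - r * C / 2 * (r * C) + a
      = a - (C * C + S * S) * (r\<^sup>2 / 2)"
    by (simp add: field_simps power2_eq_square)
  then have ok: "r * S / 2 * - (r * S) - r * C / 2 * (r * C) + a = k"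
    unfolding cs k_def by simp
  have ip: "(C * dr - r * S * d\<theta>) * - (r * S)
      + (S * dr + r * C * d\<theta>) * (r * C)
      = (C * C + S * S) * (r\<^sup>2 * d\<theta>)"
    by (simp add: algebra_simps power2_eq_square)
  have X: "X43 a (cyl (r, \<theta>, z)) = (- (r * S), r * C, a)"
    by (simp add: X43_def X4_def X3_def cyl_def CS)
  have "r\<^sup>2 * d\<theta> + m * k = heis (cyl (r, \<theta>, z)) w (X43 a (cyl (r, \<theta>, z)))"
    unfolding X unfolding heis_def cyl_def w_def split CS om ok ip cs by simp
  then have h: "r\<^sup>2 * d\<theta> = - (m * k)"
    using assms(3) by simp
  have "r\<^sup>2 * (dz - a * d\<theta>) = m * (r\<^sup>2 + k\<^sup>2)"
    using h unfolding m_def k_def by algebra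
  then have e: "dz - a * d\<theta> = m * (r\<^sup>2 + k\<^sup>2) / r\<^sup>2"
    using \<open>0 < r\<close> by (simp add: field_simps)
  have d: "d\<theta> = - (m * k) / r\<^sup>2"
    using h \<open>0 < r\<close> by (simp add: field_simps)
  have n: "4 * r\<^sup>2 + (r\<^sup>2 - 2 * a)\<^sup>2 = 4 * (r\<^sup>2 + k\<^sup>2)"
    unfolding k_def by algebra
  have pos: "r\<^sup>2 + k\<^sup>2 > 0" "r\<^sup>2 > 0"
    using \<open>0 < r\<close> by (auto intro: add_pos_nonneg)
  have "quot_iii a (inv_iii a (r, \<theta>, z)) (dr, dz - a * d\<theta>)
      = dr\<^sup>2 + 4 * r\<^sup>2 * (m * (r\<^sup>2 + k\<^sup>2) / r\<^sup>2)\<^sup>2 / (4 * (r\<^sup>2 + k\<^sup>2))"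
    unfolding quot_iii_def inv_iii_def split n e ..
  also have "4 * r\<^sup>2 * (m * (r\<^sup>2 + k\<^sup>2) / r\<^sup>2)\<^sup>2 / (4 * (r\<^sup>2 + k\<^sup>2)) = m\<^sup>2 * (r\<^sup>2 + k\<^sup>2) / r\<^sup>2"
    using pos by (simp add: divide_simps power2_eq_square)
  also have "\<dots> = r\<^sup>2 * d\<theta>\<^sup>2 + m\<^sup>2"
    unfolding d using \<open>0 < r\<close> by (simp add: field_simps power2_eq_square)
  finally show ?thesis
    unfolding g by simp
qed


section \<open>Profile curves and invariant surfaces\<close>

text \<open>Arc-length parametrized curve in the part \<open>R\<close> of the orbit space, with squared length \<open>Q\<close>.\<close>

definition profile_curve ::
  "(real \<times> real \<Rightarrow> real \<times> real \<Rightarrow> real) \<Rightarrow> (real \<times> real) set \<Rightarrow> real set \<Rightarrow> (real \<Rightarrow> real) \<Rightarrow> (real \<Rightarrow> real) \<Rightarrow> bool" where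
  "profile_curve Q R I \<xi>1 \<xi>2 \<longleftrightarrow>
     open I \<and> is_interval I \<and> \<xi>1 C1_differentiable_on I \<and> \<xi>2 C1_differentiable_on I \<and>
     (\<forall>u\<in>I. (\<xi>1 u, \<xi>2 u) \<in> R \<and> Q (\<xi>1 u, \<xi>2 u) (deriv \<xi>1 u, deriv \<xi>2 u) = 1)"

text \<open>
  \<open>M\<close> is invariant under the flow and projects onto the given curve.  In cases (i) and (ii) the
  last two conditions say that the image of \<open>M\<close> under \<open>\<Xi>\<close> is that curve; in case (iii)
  every point of \<open>M\<close> has suitable cylindrical coordinates over the curve.\<close>

definition invariant_surface ::
  "(pt \<Rightarrow> pt) \<Rightarrow> (pt \<Rightarrow> pt) \<Rightarrow> pt set \<Rightarrow> (pt \<Rightarrow> real \<times> real) \<Rightarrow> real set \<Rightarrow> (real \<Rightarrow> real) \<Rightarrow> (real \<Rightarrow> real) \<Rightarrow> pt set \<Rightarrow> bool" where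
  "invariant_surface X q C \<Xi> I \<xi>1 \<xi>2 M \<longleftrightarrow>
     (\<forall>v. flow X v ` M \<subseteq> M) \<and>
     M \<subseteq> q ` {p \<in> C. \<Xi> p \<in> (\<lambda>u. (\<xi>1 u, \<xi>2 u)) ` I} \<and>
     (\<lambda>u. (\<xi>1 u, \<xi>2 u)) ` I \<subseteq> \<Xi> ` {p \<in> C. q p \<in> M}"

definition immersion_on :: "(real \<times> real) set \<Rightarrow> (real \<times> real \<Rightarrow> pt) \<Rightarrow> bool" where
  "immersion_on S f \<longleftrightarrow> (\<exists>D. (\<forall>p\<in>S. (f has_derivative D p) (at p) \<and> inj (D p)) \<and>
     (\<forall>w. continuous_on S (\<lambda>p. D p w)))"

text \<open>
  \<open>\<psi> u v\<close> is obtained by moving a lift of the profile curve along the flow, it is an immersion,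
  and its image is \<open>M\<close>.\<close>

definition flow_parametrization ::
  "(pt \<Rightarrow> pt) \<Rightarrow> (pt \<Rightarrow> pt) \<Rightarrow> pt set \<Rightarrow> (pt \<Rightarrow> real \<times> real) \<Rightarrow> real set \<Rightarrow> (real \<Rightarrow> real) \<Rightarrow> (real \<Rightarrow> real) \<Rightarrow> pt set \<Rightarrow>
   (real \<Rightarrow> real \<Rightarrow> pt) \<Rightarrow> bool" where
  "flow_parametrization X q C \<Xi> I \<xi>1 \<xi>2 M \<psi> \<longleftrightarrow>
     (\<exists>\<gamma>. (\<forall>u\<in>I. \<exists>p\<in>C. q p = \<gamma> u \<and> \<Xi> p = (\<xi>1 u, \<xi>2 u)) \<and>
           (\<forall>u\<in>I. \<forall>v. \<psi> u v = flow X v (\<gamma> u))) \<and>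
     immersion_on (I \<times> UNIV) (\<lambda>(u, v). \<psi> u v) \<and>
     (\<lambda>(u, v). \<psi> u v) ` (I \<times> UNIV) = M"


section \<open>Loxodromes\<close>

definition loxodrome :: "(pt \<Rightarrow> pt) \<Rightarrow> pt set \<Rightarrow> real \<Rightarrow> real set \<Rightarrow> (real \<Rightarrow> pt) \<Rightarrow> bool" where
  "loxodrome X M \<theta> J \<alpha> \<longleftrightarrow>
     open J \<and> is_interval J \<and> J \<noteq> {} \<and> \<alpha> C1_differentiable_on J \<and> \<alpha> ` J \<subseteq> M \<and>
     (\<forall>s\<in>J. heis_norm (\<alpha> s) (vector_derivative \<alpha> (at s)) = 1 \<and>
            heis (\<alpha> s) (vector_derivative \<alpha> (at s)) (X (\<alpha> s)) = heis_norm (\<alpha> s) (X (\<alpha> s)) * cos \<theta>)"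

definition param_change :: "(real \<Rightarrow> real) \<Rightarrow> real set \<Rightarrow> real set \<Rightarrow> bool" where
  "param_change h J I \<longleftrightarrow> h C1_differentiable_on J \<and> (\<forall>s\<in>J. deriv h s \<noteq> 0) \<and> bij_betw h J I"

text \<open>
  \<open>v \<sigma>\<close> is the function \<open>v\<close> with the sign \<open>\<sigma>\<close> in place of the symbol \<open>\<plusminus>\<close>.
  First, for both signs the curve \<open>\<lambda>u. \<psi> u (v \<sigma> u)\<close> becomes a loxodrome of angle \<open>\<theta>\<close> after
  a regular change of parameter (which reverses the orientation for one of the two signs).
  Conversely, every loxodrome of angle \<open>\<theta>\<close> on the surface has this form after such a change
  of parameter.  The constant \<open>c\<close> is the constant of integration, that is, a translation by the flow.
  Since \<open>\<psi>\<close> need not be injective, a curve on the immersed surface is a curve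
  \<open>(U, V)\<close> in the parameter domain composed with \<open>\<psi>\<close>.\<close>

definition loxodromes_parametrized ::
  "(pt \<Rightarrow> pt) \<Rightarrow> pt set \<Rightarrow> real \<Rightarrow> real set \<Rightarrow> (real \<Rightarrow> real \<Rightarrow> pt) \<Rightarrow> (real \<Rightarrow> real \<Rightarrow> real) \<Rightarrow> bool" where
  "loxodromes_parametrized X M \<theta> I \<psi> v \<longleftrightarrow>
     (\<forall>\<sigma>\<in>{1, -1}. \<exists>J h. param_change h J I \<and> loxodrome X M \<theta> J (\<lambda>s. \<psi> (h s) (v \<sigma> (h s)))) \<and>
     (\<forall>J \<alpha> U V. loxodrome X M \<theta> J \<alpha> \<and> U C1_differentiable_on J \<and> V C1_differentiable_on J \<and>
        U ` J \<subseteq> I \<and> (\<forall>s\<in>J. \<alpha> s = \<psi> (U s) (V s)) \<longrightarrow>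
        (\<exists>\<sigma>\<in>{1, -1}. \<exists>c. param_change U J (U ` J) \<and> (\<forall>s\<in>J. V s = v \<sigma> (U s) + c)))"

definition general_helix :: "(pt \<Rightarrow> pt) \<Rightarrow> real set \<Rightarrow> (real \<Rightarrow> pt) \<Rightarrow> bool" where
  "general_helix X I \<alpha> \<longleftrightarrow> \<alpha> C1_differentiable_on I \<and>
     (\<forall>s\<in>I. vector_derivative \<alpha> (at s) \<noteq> 0) \<and>
     (\<exists>\<beta>. \<forall>s\<in>I. heis (\<alpha> s) (vector_derivative \<alpha> (at s)) (X (\<alpha> s))
        = heis_norm (\<alpha> s) (vector_derivative \<alpha> (at s)) * heis_norm (\<alpha> s) (X (\<alpha> s)) * cos \<beta>)"

text \<open>
  Choice of the branch of the square root \<open>sqrt (1 - (\<xi>1')\<^sup>2)\<close>, which comes from solving the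
  arc-length condition for \<open>\<xi>2'\<close> and hence has to carry the sign of \<open>\<xi>2'\<close>.  The constant
  function 1 is a branch sign exactly when the profile curve is oriented such that \<open>\<xi>2' \<ge> 0\<close>.\<close>

definition branch_sign :: "real set \<Rightarrow> (real \<Rightarrow> real) \<Rightarrow> (real \<Rightarrow> real) \<Rightarrow> bool" where
  "branch_sign I \<xi>2 \<epsilon> \<longleftrightarrow> (\<forall>u\<in>I. \<epsilon> u \<in> {1, -1} \<and> 0 \<le> \<epsilon> u * deriv \<xi>2 u)"

lemma branch_sign_one: "branch_sign I \<xi>2 (\<lambda>_. 1) \<longleftrightarrow> (\<forall>u\<in>I. 0 \<le> deriv \<xi>2 u)"
  by (simp add: branch_sign_def)

text \<open>
  In case (ii), writing \<open>\<xi>2\<close> as the integral of its derivative from \<open>u0\<close> presupposes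
  \<open>\<xi>2 u0 = 0\<close>.  For a profile curve in general position \<open>v\<close> gets the additional term
  \<open>- \<xi>2 u0 / 2 * (\<xi>1 u - \<xi>1 u0)\<close>, which vanishes under this normalization.\<close>

end

(* Each parametrization \<psi> has a first fundamental form E du^2 + 2 F du dv + G dv^2 whose
   coefficients depend on u only, and X is \<psi>_v.  The arc-length condition on the profile curve says
   exactly E - F^2 / G = 1, so for a unit-speed curve (u(s), v(s)) one has
   u'^2 + (F u' + G v')^2 / G = 1, while the angle condition is F u' + G v' = sqrt G cos \<theta>.
   Hence u' = sin \<theta> or u' = - sin \<theta>, with constant sign \<sigma> by connectedness, and
   dv/du = \<sigma> cot \<theta> / sqrt G - F / G.  The three formulas result from inserting F and G and
   eliminating \<xi>2' by the arc-length condition. *)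
theory Submission
  imports Defs
begin

section \<open>Real-variable preliminaries\<close>

text \<open>E, F and G lose v because the flow acts by isometries; in each case this is checked by
  direct computation. The quantity E - F^2 / G is the squared length of the part of \<psi>_u
  orthogonal to X. A Riemannian submersion preserves that length, so it equals the squared speed 1
  of the profile curve. Excluding orbits gives sin \<theta> > 0. This keeps the two possible values
  of u' apart, so u' cannot change sign along a connected loxodrome, and it lets u serve as a
  parameter. The integrands need some care: a branch sign \<epsilon> is free at the zeros of \<xi>2'
  and may jump there. The integrals are therefore differentiated through the closed form of dv/du,
  where \<epsilon> times the square root has been replaced by a multiple of \<xi>2' and continuity
  is evident.\<close>

lemma affine_if_deriv_const:
  fixes f :: "real \<Rightarrow> real"
  assumes "\<And>w. (f has_real_derivative c) (at w)"
  shows "f w = f 0 + c * w"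
proof -
  have "((\<lambda>w. f w - c * w) has_real_derivative 0) (at w)" for w
    by (auto intro!: derivative_eq_intros assms)
  then have "f w - c * w = f 0 - c * 0"
    by (intro DERIV_isconst_all) blast
  then show ?thesis by simp
qed

lemma has_vector_derivative_triple:
  fixes f :: "real \<Rightarrow> pt"
  shows "(f has_vector_derivative (a, b, c)) (at w) \<longleftrightarrow>
     ((\<lambda>w. fst (f w)) has_real_derivative a) (at w) \<and>
     ((\<lambda>w. fst (snd (f w))) has_real_derivative b) (at w) \<and>
     ((\<lambda>w. snd (snd (f w))) has_real_derivative c) (at w)"
proof
  assume "(f has_vector_derivative (a, b, c)) (at w)"
  then have "(f has_derivative (\<lambda>h. (h * a, h * b, h * c))) (at w)"
    by (simp add: has_vector_derivative_def)
  from has_derivative_fst[OF this] has_derivative_fst[OF has_derivative_snd[OF this]]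
    has_derivative_snd[OF has_derivative_snd[OF this]]
  show "((\<lambda>w. fst (f w)) has_real_derivative a) (at w) \<and>
     ((\<lambda>w. fst (snd (f w))) has_real_derivative b) (at w) \<and>
     ((\<lambda>w. snd (snd (f w))) has_real_derivative c) (at w)"
    by (simp add: has_field_derivative_def mult_commute_abs)
next
  assume "((\<lambda>w. fst (f w)) has_real_derivative a) (at w) \<and>
     ((\<lambda>w. fst (snd (f w))) has_real_derivative b) (at w) \<and>
     ((\<lambda>w. snd (snd (f w))) has_real_derivative c) (at w)"
  then have "((\<lambda>w. (fst (f w), fst (snd (f w)), snd (snd (f w)))) has_vector_derivative (a, b, c)) (at w)"
    unfolding has_real_derivative_iff_has_vector_derivative
    by (intro has_vector_derivative_Pair) blast+
  then show "(f has_vector_derivative (a, b, c)) (at w)"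
    by simp
qed

text \<open>Two functions appear because \<open>f\<close> is to be an integrand containing the
  branch sign, while \<open>g\<close> is its closed form, which is visibly continuous. They agree
  only on \<open>I\<close>, so the integrals are compared on a neighbourhood of \<open>u\<close>
  inside \<open>I\<close>.\<close>

lemma interval_integral_has_real_derivative:
  fixes f g :: "real \<Rightarrow> real"
  assumes "open I" "is_interval I" "u0 \<in> I" "u \<in> I" "continuous_on I g" "\<And>t. t \<in> I \<Longrightarrow> f t = g t"
  shows "((\<lambda>u. LBINT t=u0..u. f t) has_real_derivative g u) (at u)"
proof -
  have "min u0 u \<in> I" "max u0 u \<in> I"
    using assms(3,4) by (auto simp: min_def max_def)
  obtain d where "d > 0" "ball (min u0 u) d \<subseteq> I"
    using \<open>open I\<close> \<open>min u0 u \<in> I\<close> by (rule openE)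
  obtain e where "e > 0" "ball (max u0 u) e \<subseteq> I"
    using \<open>open I\<close> \<open>max u0 u \<in> I\<close> by (rule openE)
  with \<open>d > 0\<close> \<open>ball (min u0 u) d \<subseteq> I\<close> have mem: "min u0 u - d / 2 \<in> I" "max u0 u + e / 2 \<in> I"
    by (auto simp: dist_real_def subset_iff)
  \<comment> \<open>The closed interval from \<open>l\<close> to \<open>r\<close> stays in
    \<open>I\<close> and has both \<open>u0\<close> and \<open>u\<close> in its interior, so the
    derivative within it is a two-sided one, whichever of the two points comes first.\<close>
  define l r where "l = min u0 u - d / 2" and "r = max u0 u + e / 2"
  have lr: "l < u0" "l < u" "u0 < r" "u < r"
    using \<open>d > 0\<close> \<open>e > 0\<close> by (auto simp: l_def r_def min_def max_def)
  have sub: "{l..r} \<subseteq> I"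
    using mem \<open>is_interval I\<close> unfolding l_def[symmetric] r_def[symmetric]
    by (meson atLeastAtMost_iff mem_is_interval_1_I subsetI)
  have "((\<lambda>u. LBINT t=u0..u. g t) has_vector_derivative g u) (at u within {l..r})"
    using lr sub assms(5) by (intro interval_integral_FTC2) (auto intro: continuous_on_subset)
  then have "((\<lambda>u. LBINT t=u0..u. g t) has_vector_derivative g u) (at u)"
    using lr by (simp only: at_within_Icc_at)
  then have "((\<lambda>u. LBINT t=u0..u. f t) has_vector_derivative g u) (at u)"
  proof (rule has_vector_derivative_transform_within_open[where S="{l<..<r}"])
    show "open {l<..<r}" "u \<in> {l<..<r}"
      using lr by auto
    fix y assume "y \<in> {l<..<r}"
    then have y: "l < y" "y < r" by auto
    show "(LBINT t=u0..y. g t) = (LBINT t=u0..y. f t)"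
    proof (rule interval_integral_cong)
      fix x assume "x \<in> einterval (min (ereal u0) (ereal y)) (max (ereal u0) (ereal y))"
      then have "l \<le> x" "x \<le> r"
        using lr y by (auto simp: einterval_def min_def max_def split: if_splits)
      then show "g x = f x"
        using sub assms(6) by (simp add: subset_iff)
    qed
  qed
  then show ?thesis
    by (simp add: has_real_derivative_iff_has_vector_derivative)
qed

section \<open>C1 functions of one variable and constancy on connected sets\<close>

lemma C1_differentiable_on_derivD:
  fixes f :: "real \<Rightarrow> real"
  assumes "f C1_differentiable_on S"
  shows "\<And>s. s \<in> S \<Longrightarrow> (f has_real_derivative deriv f s) (at s)" and "continuous_on S (deriv f)"
proof -
  obtain D where D: "\<And>s. s \<in> S \<Longrightarrow> (f has_vector_derivative D s) (at s)" "continuous_on S D"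
    using assms unfolding C1_differentiable_on_def by blast
  have eq: "deriv f s = D s" if "s \<in> S" for s
    using D(1)[OF that] by (simp add: DERIV_imp_deriv has_real_derivative_iff_has_vector_derivative)
  show "(f has_real_derivative deriv f s) (at s)" if "s \<in> S" for s
    using D(1)[OF that] eq[OF that] by (simp add: has_real_derivative_iff_has_vector_derivative)
  show "continuous_on S (deriv f)"
    using D(2) eq by (simp cong: continuous_on_cong)
qed

lemma C1_differentiable_onI:
  fixes f :: "real \<Rightarrow> real"
  assumes "\<And>s. s \<in> S \<Longrightarrow> (f has_real_derivative D s) (at s)" "continuous_on S D"
  shows "f C1_differentiable_on S"
  using assms unfolding C1_differentiable_on_def has_real_derivative_iff_has_vector_derivative by blast

lemma constant_on_interval:
  fixes f :: "real \<Rightarrow> real"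
  assumes "is_interval S" "\<And>s. s \<in> S \<Longrightarrow> (f has_real_derivative 0) (at s)"
  shows "\<exists>c. \<forall>s\<in>S. f s = c"
  using assms by (intro has_field_derivative_zero_constant)
    (auto simp: is_interval_convex_1 intro: has_field_derivative_at_within)

text \<open>A continuous function with finite range on a connected set is constant. Applied to u'
  with \<open>c\<close> = sin \<theta>, this yields a single sign for the whole loxodrome.\<close>

lemma connected_two_values:
  fixes f :: "real \<Rightarrow> real"
  assumes "connected S" "continuous_on S f" "\<And>s. s \<in> S \<Longrightarrow> f s = c \<or> f s = - c"
  obtains \<sigma> where "\<sigma> \<in> {1, -1}" "\<And>s. s \<in> S \<Longrightarrow> f s = \<sigma> * c"
proof (cases "\<exists>s\<in>S. f s = c")
  case True
  then obtain r where r: "r \<in> S" "f r = c" by blast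
  have "f constant_on S"
    using assms by (intro continuous_finite_range_constant)
      (auto intro: finite_subset[where B="{c, - c}"])
  then have "f s = 1 * c" if "s \<in> S" for s
    using r that by (auto simp: constant_on_def)
  then show ?thesis
    by (intro that[of 1]) auto
next
  case False
  then show ?thesis
    using assms(3) by (intro that[of "-1"]) auto
qed

section \<open>Parametrizations with an orbit-independent first fundamental form\<close>

lemma heis_bilinear:
  "heis p w (h *\<^sub>R A + k *\<^sub>R B) = h * heis p w A + k * heis p w B"
  "heis p (h *\<^sub>R A + k *\<^sub>R B) w = h * heis p A w + k * heis p B w"
  by (auto simp: heis_def field_simps split: prod.splits)

lemma heis_commute: "heis p v w = heis p w v"
  by (auto simp: heis_def split: prod.splits)

text \<open>\<open>A\<close> and \<open>B\<close> stand for \<psi>_u and \<psi>_v. The relation E -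
  F^2 / G = 1 enters as \<open>arc_length\<close> with the denominator cleared, the form that the
  profile metrics yield by polynomial arithmetic. The surface \<open>M\<close> itself is left out:
  only the image of \<psi> matters for loxodromes.\<close>

locale invariant_parametrization =
  fixes X :: "pt \<Rightarrow> pt" and I :: "real set" and \<psi> A B :: "real \<Rightarrow> real \<Rightarrow> pt" and E F G :: "real \<Rightarrow> real"
  assumes I: "open I" "is_interval I"
    and deriv: "u \<in> I \<Longrightarrow>
      ((\<lambda>(u, v). \<psi> u v) has_derivative (\<lambda>(h, k). h *\<^sub>R A u v + k *\<^sub>R B u v)) (at (u, v))"
    and cont: "continuous_on (I \<times> UNIV) (\<lambda>(u, v). A u v)" "continuous_on (I \<times> UNIV) (\<lambda>(u, v). B u v)"
    and X: "u \<in> I \<Longrightarrow> X (\<psi> u v) = B u v"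
    and E: "u \<in> I \<Longrightarrow> heis (\<psi> u v) (A u v) (A u v) = E u"
    and F: "u \<in> I \<Longrightarrow> heis (\<psi> u v) (A u v) (B u v) = F u"
    and G: "u \<in> I \<Longrightarrow> heis (\<psi> u v) (B u v) (B u v) = G u"
    and G_pos: "u \<in> I \<Longrightarrow> 0 < G u"
    and arc_length: "u \<in> I \<Longrightarrow> E u * G u - (F u)\<^sup>2 = G u"
    and cont_F: "continuous_on I F" and cont_G: "continuous_on I G"
begin

text \<open>Completing the square: inserting E = 1 + F^2 / G into h^2 E + 2 h k F + k^2 G splits the
  squared length into h^2, from the part orthogonal to X, and (h F + k G)^2 / G, from the part along
  X.\<close>

lemma heis_tangent:
  assumes "u \<in> I"
  shows "heis (\<psi> u v) (h *\<^sub>R A u v + k *\<^sub>R B u v) (X (\<psi> u v)) = h * F u + k * G u"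
    and "heis (\<psi> u v) (h *\<^sub>R A u v + k *\<^sub>R B u v) (h *\<^sub>R A u v + k *\<^sub>R B u v)
      = h\<^sup>2 + (h * F u + k * G u)\<^sup>2 / G u"
proof -
  show "heis (\<psi> u v) (h *\<^sub>R A u v + k *\<^sub>R B u v) (X (\<psi> u v)) = h * F u + k * G u"
    using assms by (simp add: X heis_bilinear F G)
  have "heis (\<psi> u v) (h *\<^sub>R A u v + k *\<^sub>R B u v) (h *\<^sub>R A u v + k *\<^sub>R B u v)
      = h * (h * E u + k * F u) + k * (h * F u + k * G u)"
    using assms by (simp only: heis_bilinear heis_commute[of _ "B u v" "A u v"] E F G)
  moreover have "E u = 1 + (F u)\<^sup>2 / G u"
    using arc_length[OF assms] G_pos[OF assms] by (simp add: field_simps)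
  ultimately show "heis (\<psi> u v) (h *\<^sub>R A u v + k *\<^sub>R B u v) (h *\<^sub>R A u v + k *\<^sub>R B u v)
      = h\<^sup>2 + (h * F u + k * G u)\<^sup>2 / G u"
    using G_pos[OF assms] by (simp add: field_simps power2_eq_square)
qed

lemma heis_norm_X: "u \<in> I \<Longrightarrow> heis_norm (\<psi> u v) (X (\<psi> u v)) = sqrt (G u)"
  by (simp add: heis_norm_def X G)

text \<open>The product with X forces h F + k G = 0, then the squared length reduces to h^2, and
  finally G > 0 gives k = 0. This yields both the immersion property and the nonvanishing velocity
  of the helices.\<close>

lemma tangent_eq_0:
  assumes "u \<in> I" "h *\<^sub>R A u v + k *\<^sub>R B u v = 0"
  shows "h = 0 \<and> k = 0"
proof -
  have z: "heis p 0 w = 0" for p w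
    by (auto simp: heis_def zero_prod_def split: prod.splits)
  have 1: "h * F u + k * G u = 0"
    using heis_tangent(1)[OF assms(1), of v h k] assms(2) by (simp add: z)
  have "h = 0"
    using heis_tangent(2)[OF assms(1), of v h k] assms(2) 1 by (simp add: z)
  then show ?thesis
    using 1 G_pos[OF assms(1)] by simp
qed

lemma immersion: "immersion_on (I \<times> UNIV) (\<lambda>(u, v). \<psi> u v)"
  unfolding immersion_on_def
proof (intro exI conjI ballI allI)
  let ?D = "\<lambda>(u, v) (h, k). h *\<^sub>R A u v + k *\<^sub>R B u v"
  fix p assume "p \<in> I \<times> (UNIV :: real set)"
  then obtain u v where p: "p = (u, v)" "u \<in> I" by auto
  show d: "((\<lambda>(u, v). \<psi> u v) has_derivative ?D p) (at p)"
    using deriv[OF p(2)] by (simp add: p)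
  have "linear (?D p)"
    using d by (rule has_derivative_linear)
  then show "inj (?D p)"
    using tangent_eq_0[OF p(2)] by (auto simp: linear_injective_0 p zero_prod_def)
next
  fix w :: "real \<times> real"
  obtain h k where "w = (h, k)" by fastforce
  moreover have "continuous_on (I \<times> UNIV) (\<lambda>p. h *\<^sub>R (\<lambda>(u, v). A u v) p + k *\<^sub>R (\<lambda>(u, v). B u v) p)"
    by (intro continuous_intros cont)
  ultimately show "continuous_on (I \<times> UNIV) (\<lambda>p. (\<lambda>(u, v) (h, k). h *\<^sub>R A u v + k *\<^sub>R B u v) p w)"
    by (simp add: case_prod_beta)
qed

section \<open>Curves on the surface given by a pair of coordinate functions\<close>

lemma curve_has_vector_derivative:
  assumes "(U has_real_derivative h) (at s)" "(V has_real_derivative k) (at s)" "U s \<in> I"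
  shows "((\<lambda>s. \<psi> (U s) (V s)) has_vector_derivative
    (h *\<^sub>R A (U s) (V s) + k *\<^sub>R B (U s) (V s))) (at s)"
proof -
  have "((\<lambda>s. (U s, V s)) has_derivative (\<lambda>x. (x * h, x * k))) (at s)"
    using assms(1,2)
    by (intro has_derivative_Pair) (simp_all add: has_field_derivative_def mult_commute_abs)
  from has_derivative_compose[OF this deriv[OF assms(3)]]
  show ?thesis
    by (simp add: has_vector_derivative_def algebra_simps)
qed

lemma curve_C1:
  assumes U: "\<And>s. s \<in> J \<Longrightarrow> (U has_real_derivative U' s) (at s)" "continuous_on J U'"
    and V: "\<And>s. s \<in> J \<Longrightarrow> (V has_real_derivative V' s) (at s)" "continuous_on J V'"
    and sub: "U ` J \<subseteq> I"
  shows "(\<lambda>s. \<psi> (U s) (V s)) C1_differentiable_on J"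
proof -
  have cUV: "continuous_on J (\<lambda>s. (U s, V s))"
    using U(1) V(1) by (intro continuous_intros continuous_at_imp_continuous_on)
      (auto intro: DERIV_isCont)
  have mem: "(\<lambda>s. (U s, V s)) ` J \<subseteq> I \<times> UNIV"
    using sub by auto
  have "continuous_on J (\<lambda>s. A (U s) (V s))" "continuous_on J (\<lambda>s. B (U s) (V s))"
    using continuous_on_compose2[OF cont(1) cUV mem] continuous_on_compose2[OF cont(2) cUV mem]
    by auto
  then have "continuous_on J (\<lambda>s. U' s *\<^sub>R A (U s) (V s) + V' s *\<^sub>R B (U s) (V s))"
    using U(2) V(2) by (intro continuous_intros)
  moreover have "((\<lambda>s. \<psi> (U s) (V s)) has_vector_derivative
    (U' s *\<^sub>R A (U s) (V s) + V' s *\<^sub>R B (U s) (V s))) (at s)" if "s \<in> J" for s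
    using that sub by (intro curve_has_vector_derivative U(1) V(1)) auto
  ultimately show ?thesis
    unfolding C1_differentiable_on_def
    by (intro exI[of _ "\<lambda>s. U' s *\<^sub>R A (U s) (V s) + V' s *\<^sub>R B (U s) (V s)"]) simp
qed

section \<open>The differential equation of loxodromes and its solutions\<close>

definition slope :: "real \<Rightarrow> real \<Rightarrow> real \<Rightarrow> real" where
  "slope \<theta> \<sigma> u = \<sigma> * cot \<theta> / sqrt (G u) - F u / G u"

lemma continuous_on_slope: "continuous_on I (slope \<theta> \<sigma>)"
  unfolding slope_def using G_pos
  by (intro continuous_intros cont_F cont_G) (fastforce dest: G_pos)+

text \<open>Once the angle equation fixes h F + k G = sqrt G cos \<theta>, the length equation no
  longer involves F and G and becomes h^2 = (sin \<theta>)^2. Constructing loxodromes uses the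
  implication from right to left, classifying them the other one.\<close>

lemma angle_iff_slope:
  assumes u: "u \<in> I" and \<theta>: "0 < \<theta>" "\<theta> < pi"
  shows "heis_norm (\<psi> u v) (h *\<^sub>R A u v + k *\<^sub>R B u v) = 1 \<and>
      heis (\<psi> u v) (h *\<^sub>R A u v + k *\<^sub>R B u v) (X (\<psi> u v)) = heis_norm (\<psi> u v) (X (\<psi> u v)) * cos \<theta>
    \<longleftrightarrow> (\<exists>\<sigma>\<in>{1, -1}. h = \<sigma> * sin \<theta> \<and> k = h * slope \<theta> \<sigma> u)" (is "?L \<longleftrightarrow> ?R")
proof -
  have s: "0 < sin \<theta>" using \<theta> by (rule sin_gt_zero)
  define g where "g = sqrt (G u)"
  have g: "0 < g" "G u = g\<^sup>2"
    using G_pos[OF u] by (auto simp: g_def)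
  have L: "?L \<longleftrightarrow> h\<^sup>2 + (h * F u + k * G u)\<^sup>2 / G u = 1 \<and> h * F u + k * G u = g * cos \<theta>"
    using u by (simp add: heis_norm_X heis_tangent(1) g_def)
      (simp add: heis_norm_def heis_tangent(2))
  also have "\<dots> \<longleftrightarrow> h\<^sup>2 + (cos \<theta>)\<^sup>2 = 1 \<and> h * F u + k * G u = g * cos \<theta>"
    using g by (auto simp: power_mult_distrib)
  also have "\<dots> \<longleftrightarrow> h\<^sup>2 = (sin \<theta>)\<^sup>2 \<and> h * F u + k * G u = g * cos \<theta>"
    by (simp add: sin_squared_eq) linarith
  also have "\<dots> \<longleftrightarrow> (\<exists>\<sigma>\<in>{1, -1}. h = \<sigma> * sin \<theta> \<and> h * F u + k * G u = g * cos \<theta>)"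
    by (auto simp: power2_eq_iff)
  also have "\<dots> \<longleftrightarrow> ?R"
  proof (intro bex_cong refl conj_cong)
    fix \<sigma> :: real assume \<sigma>: "\<sigma> \<in> {1, -1}" and h: "h = \<sigma> * sin \<theta>"
    \<comment> \<open>The sign occurs once in \<open>h\<close> and once in front of cot \<theta>, so
      it cancels: the component along X is the same for both signs.\<close>
    have "h * slope \<theta> \<sigma> u = (\<sigma> * \<sigma>) * cos \<theta> / g - h * F u / g\<^sup>2"
      using s by (simp add: slope_def cot_def h g(2)[symmetric] g_def[symmetric] field_simps)
    also have "\<sigma> * \<sigma> = 1" using \<sigma> by auto
    finally have "h * slope \<theta> \<sigma> u * G u = g * cos \<theta> - h * F u"
      using g by (simp add: field_simps power2_eq_square)
    moreover have "k = h * slope \<theta> \<sigma> u \<longleftrightarrow> k * G u = h * slope \<theta> \<sigma> u * G u"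
      using G_pos[OF u] by simp
    ultimately show "h * F u + k * G u = g * cos \<theta> \<longleftrightarrow> k = h * slope \<theta> \<sigma> u"
      by linarith
  qed
  finally show ?thesis .
qed

text \<open>Only the derivative of \<open>v\<close> matters: any primitive of the slope serves, and
  the freedom in choosing it is the constant in the converse part, a shift along the flow.\<close>

lemma loxodromes:
  assumes u0: "u0 \<in> I" and \<theta>: "0 < \<theta>" "\<theta> < pi"
    and M: "(\<lambda>(u, v). \<psi> u v) ` (I \<times> UNIV) = M"
    and v: "\<And>\<sigma> u. u \<in> I \<Longrightarrow> (v \<sigma> has_real_derivative slope \<theta> \<sigma> u) (at u)"
  shows "loxodromes_parametrized X M \<theta> I \<psi> v"
  unfolding loxodromes_parametrized_def
proof (intro conjI ballI allI impI)
  have s: "0 < sin \<theta>" using \<theta> by (rule sin_gt_zero)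
  fix \<sigma> :: real assume \<sigma>: "\<sigma> \<in> {1, -1}"
  \<comment> \<open>This is the constant value of u' at unit speed, so u is a linear function of arc
    length and \<open>J\<close> is a rescaled copy of \<open>I\<close>, reversed when
    \<open>c\<close> is negative.\<close>
  define c where "c = \<sigma> * sin \<theta>"
  have c: "c \<noteq> 0" using \<sigma> s by (auto simp: c_def)
  define h where "h = (\<lambda>s::real. c * s)"
  define J where "J = h -` I"
  have hI: "h s \<in> I" if "s \<in> J" for s using that by (simp add: J_def)
  have dh: "(h has_real_derivative c) (at s)" for s
    unfolding h_def by (auto intro!: derivative_eq_intros)
  have img: "h ` J = I"
  proof
    show "I \<subseteq> h ` J"
    proof
      fix u assume "u \<in> I"
      then show "u \<in> h ` J"
        using c by (intro image_eqI[of _ _ "u / c"]) (auto simp: J_def h_def)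
    qed
  qed (auto simp: J_def)
  have "open J"
    unfolding J_def h_def by (intro open_vimage I continuous_intros)
  have "is_interval J"
    unfolding J_def h_def is_interval_convex_1
    by (intro convex_linear_vimage) (use I in \<open>auto simp: is_interval_convex_1 linear_iff algebra_simps\<close>)
  have "J \<noteq> {}" using img u0 by auto
  have dv: "((\<lambda>s. v \<sigma> (h s)) has_real_derivative c * slope \<theta> \<sigma> (h s)) (at s)" if "s \<in> J" for s
    using DERIV_chain2[OF v[OF hI[OF that]] dh] by (simp add: mult.commute)
  have ch: "continuous_on J h" unfolding h_def by (intro continuous_intros)
  have cslope: "continuous_on J (\<lambda>s. c * slope \<theta> \<sigma> (h s))"
    using hI by (intro continuous_intros continuous_on_compose2[OF continuous_on_slope ch]) auto
  have "param_change h J I"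
    unfolding param_change_def bij_betw_def
    using c img by (auto intro!: C1_differentiable_onI[where D="\<lambda>_. c"] dh simp: DERIV_imp_deriv[OF dh])
      (auto simp: h_def inj_on_def)
  moreover have "loxodrome X M \<theta> J (\<lambda>s. \<psi> (h s) (v \<sigma> (h s)))"
    unfolding loxodrome_def
  proof (intro conjI ballI)
    show "(\<lambda>s. \<psi> (h s) (v \<sigma> (h s))) C1_differentiable_on J"
      by (rule curve_C1[OF dh _ dv cslope]) (auto simp: img)
    show "(\<lambda>s. \<psi> (h s) (v \<sigma> (h s))) ` J \<subseteq> M"
      using hI M by force
    fix s assume "s \<in> J"
    note hI = hI[OF this] and dv = dv[OF this]
    have "vector_derivative (\<lambda>s. \<psi> (h s) (v \<sigma> (h s))) (at s)
        = c *\<^sub>R A (h s) (v \<sigma> (h s)) + (c * slope \<theta> \<sigma> (h s)) *\<^sub>R B (h s) (v \<sigma> (h s))"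
      by (intro vector_derivative_at curve_has_vector_derivative dh dv hI)
    then show "heis_norm (\<psi> (h s) (v \<sigma> (h s))) (vector_derivative (\<lambda>s. \<psi> (h s) (v \<sigma> (h s))) (at s)) = 1"
      "heis (\<psi> (h s) (v \<sigma> (h s))) (vector_derivative (\<lambda>s. \<psi> (h s) (v \<sigma> (h s))) (at s)) (X (\<psi> (h s) (v \<sigma> (h s))))
        = heis_norm (\<psi> (h s) (v \<sigma> (h s))) (X (\<psi> (h s) (v \<sigma> (h s)))) * cos \<theta>"
      using angle_iff_slope[OF hI \<theta>, of "v \<sigma> (h s)" c "c * slope \<theta> \<sigma> (h s)"] \<sigma>
      by (auto simp: c_def)
  qed fact+
  ultimately show "\<exists>J h. param_change h J I \<and> loxodrome X M \<theta> J (\<lambda>s. \<psi> (h s) (v \<sigma> (h s)))"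
    by blast
next
  have s: "0 < sin \<theta>" using \<theta> by (rule sin_gt_zero)
  fix J \<alpha> and U V :: "real \<Rightarrow> real"
  assume "loxodrome X M \<theta> J \<alpha> \<and> U C1_differentiable_on J \<and> V C1_differentiable_on J \<and>
    U ` J \<subseteq> I \<and> (\<forall>s\<in>J. \<alpha> s = \<psi> (U s) (V s))"
  then have lox: "loxodrome X M \<theta> J \<alpha>" and C1: "U C1_differentiable_on J" "V C1_differentiable_on J"
    and UI: "\<And>s. s \<in> J \<Longrightarrow> U s \<in> I" and \<alpha>: "\<And>s. s \<in> J \<Longrightarrow> \<alpha> s = \<psi> (U s) (V s)"
    by auto
  have J: "open J" "is_interval J"
    using lox by (auto simp: loxodrome_def)
  have conJ: "connected J" using J(2) by (simp add: is_interval_connected)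
  note dU = C1_differentiable_on_derivD[OF C1(1)] and dV = C1_differentiable_on_derivD[OF C1(2)]
  have angle: "\<exists>\<sigma>\<in>{1, -1}. deriv U s = \<sigma> * sin \<theta> \<and> deriv V s = deriv U s * slope \<theta> \<sigma> (U s)"
    if "s \<in> J" for s
  proof -
    have "((\<lambda>s. \<psi> (U s) (V s)) has_vector_derivative
      (deriv U s *\<^sub>R A (U s) (V s) + deriv V s *\<^sub>R B (U s) (V s))) (at s)"
      by (intro curve_has_vector_derivative dU dV UI that)
    then have "(\<alpha> has_vector_derivative
      (deriv U s *\<^sub>R A (U s) (V s) + deriv V s *\<^sub>R B (U s) (V s))) (at s)"
      by (rule has_vector_derivative_transform_within_open) (use J that \<alpha> in auto)
    then have "vector_derivative \<alpha> (at s) = deriv U s *\<^sub>R A (U s) (V s) + deriv V s *\<^sub>R B (U s) (V s)"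
      by (rule vector_derivative_at)
    then show ?thesis
      using lox that \<alpha>[OF that] angle_iff_slope[OF UI[OF that] \<theta>, of "V s" "deriv U s" "deriv V s"]
      unfolding loxodrome_def by auto
  qed
  obtain \<sigma> where \<sigma>: "\<sigma> \<in> {1, -1}" "\<And>s. s \<in> J \<Longrightarrow> deriv U s = \<sigma> * sin \<theta>"
    using connected_two_values[OF conJ dU(2), of "sin \<theta>"] angle by (auto; blast)
  have V': "deriv V s = deriv U s * slope \<theta> \<sigma> (U s)" if "s \<in> J" for s
    using angle[OF that] \<sigma>(1) \<sigma>(2)[OF that] s by auto
  have U0: "deriv U s \<noteq> 0" if "s \<in> J" for s
    using \<sigma>(1) \<sigma>(2)[OF that] s by auto
  \<comment> \<open>With constant nonzero derivative, \<open>U\<close> is affine on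
    \<open>J\<close>; its injectivity follows from this explicit form.\<close>
  have "((\<lambda>s. U s - \<sigma> * sin \<theta> * s) has_real_derivative 0) (at s)" if "s \<in> J" for s
    using dU(1)[OF that] \<sigma>(2)[OF that] by (auto intro!: derivative_eq_intros)
  then obtain d where d: "\<forall>s\<in>J. U s - \<sigma> * sin \<theta> * s = d"
    using constant_on_interval[OF J(2), of "\<lambda>s. U s - \<sigma> * sin \<theta> * s"] by blast
  have "inj_on U J"
  proof (rule inj_onI)
    fix x y assume "x \<in> J" "y \<in> J" "U x = U y"
    then have "\<sigma> * sin \<theta> * x = \<sigma> * sin \<theta> * y" using bspec[OF d, of x] bspec[OF d, of y] by linarith
    moreover have "\<sigma> * sin \<theta> \<noteq> 0" using \<sigma>(1) s by auto
    ultimately show "x = y" by (metis mult_left_cancel)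
  qed
  then have "param_change U J (U ` J)"
    using C1 U0 by (auto simp: param_change_def bij_betw_def)
  \<comment> \<open>Both terms satisfy the same differential equation along \<open>U\<close>, so
    they differ by the constant of integration.\<close>
  moreover have "((\<lambda>s. V s - v \<sigma> (U s)) has_real_derivative 0) (at s)" if "s \<in> J" for s
    using DERIV_diff[OF dV(1)[OF that] DERIV_chain2[OF v[OF UI[OF that]] dU(1)[OF that]], of \<sigma>]
      V'[OF that] by (simp add: mult.commute)
  then obtain e where "\<forall>s\<in>J. V s - v \<sigma> (U s) = e"
    using constant_on_interval[OF J(2), of "\<lambda>s. V s - v \<sigma> (U s)"] by blast
  then have "\<forall>s\<in>J. V s = v \<sigma> (U s) + e"
    by (metis add.commute diff_add_cancel)
  ultimately show "\<exists>\<sigma>\<in>{1, -1}. \<exists>c. param_change U J (U ` J) \<and> (\<forall>s\<in>J. V s = v \<sigma> (U s) + c)"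
    using \<sigma>(1) by blast
qed

text \<open>With u as parameter the velocity is the unit velocity of the loxodrome divided by
  \<sigma> sin \<theta>. Its length is 1 / sin \<theta>, and division by it keeps the angle with X
  constant.\<close>

lemma general_helix_slope:
  assumes \<theta>: "0 < \<theta>" "\<theta> < pi" and \<sigma>: "\<sigma> \<in> {1, -1}"
    and v: "\<And>u. u \<in> I \<Longrightarrow> (v has_real_derivative slope \<theta> \<sigma> u) (at u)"
  shows "general_helix X I (\<lambda>u. \<psi> u (v u))"
  unfolding general_helix_def
proof (intro conjI ballI exI)
  have s: "0 < sin \<theta>" using \<theta> by (rule sin_gt_zero)
  \<comment> \<open>For the sign -1, increasing u runs against the loxodrome, which turns the angle
    into its supplement.\<close>
  define \<beta> where "\<beta> = (if \<sigma> = 1 then \<theta> else pi - \<theta>)"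
  have \<beta>: "cos \<beta> = \<sigma> * cos \<theta>"
    using \<sigma> by (auto simp: \<beta>_def cos_diff)
  show "(\<lambda>u. \<psi> u (v u)) C1_differentiable_on I"
    by (rule curve_C1[where U'="\<lambda>_. 1", OF _ _ v continuous_on_slope]) auto
  fix u assume u: "u \<in> I"
  have vd: "vector_derivative (\<lambda>u. \<psi> u (v u)) (at u) = 1 *\<^sub>R A u (v u) + slope \<theta> \<sigma> u *\<^sub>R B u (v u)"
    by (intro vector_derivative_at curve_has_vector_derivative DERIV_ident v u)
  show "vector_derivative (\<lambda>u. \<psi> u (v u)) (at u) \<noteq> 0"
    unfolding vd using tangent_eq_0[OF u] by fastforce
  define g where "g = sqrt (G u)"
  have g: "0 < g" "G u = g\<^sup>2"
    using G_pos[OF u] by (auto simp: g_def)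
  have lin: "1 * F u + slope \<theta> \<sigma> u * G u = \<sigma> * cot \<theta> * g"
    using g by (simp add: slope_def g_def[symmetric] field_simps power2_eq_square)
  have "1 + (\<sigma> * cot \<theta>)\<^sup>2 = 1 / (sin \<theta>)\<^sup>2"
    using s \<sigma> by (auto simp: cot_def field_simps)
  then have "sqrt (1\<^sup>2 + (\<sigma> * cot \<theta> * g)\<^sup>2 / g\<^sup>2) = 1 / sin \<theta>"
    using s g(1) by (simp add: power_mult_distrib real_sqrt_divide)
  then have "heis_norm (\<psi> u (v u)) (1 *\<^sub>R A u (v u) + slope \<theta> \<sigma> u *\<^sub>R B u (v u)) = 1 / sin \<theta>"
    unfolding heis_norm_def heis_tangent(2)[OF u] lin unfolding g(2) .
  moreover have "\<sigma> * cot \<theta> * g = 1 / sin \<theta> * g * (\<sigma> * cos \<theta>)"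
    by (simp add: cot_def)
  ultimately show "heis (\<psi> u (v u)) (vector_derivative (\<lambda>u. \<psi> u (v u)) (at u)) (X (\<psi> u (v u)))
      = heis_norm (\<psi> u (v u)) (vector_derivative (\<lambda>u. \<psi> u (v u)) (at u))
        * heis_norm (\<psi> u (v u)) (X (\<psi> u (v u))) * cos \<beta>"
    unfolding vd heis_tangent(1)[OF u] heis_norm_X[OF u] lin \<beta> g_def[symmetric] by simp
qed

end

section \<open>Flows and orbit spaces\<close>

text \<open>\<open>flow\<close> is a definite description, so besides exhibiting a flow one must
  show that every flow agrees with it. For the three fields this uniqueness comes from solving the
  equations explicitly.\<close>

lemma flow_eqI:
  assumes "is_flow X \<phi>" "\<And>\<phi>' v p. is_flow X \<phi>' \<Longrightarrow> \<phi>' v p = \<phi> v p"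
  shows "flow X = \<phi>"
  unfolding flow_def by (rule the_equality[of "is_flow X", OF assms(1)]) (intro ext assms(2))

lemma is_flowD:
  assumes "is_flow X \<phi>"
  shows "\<phi> 0 p = p" and "((\<lambda>w. \<phi> w p) has_vector_derivative X (\<phi> v p)) (at v)"
  using assms unfolding is_flow_def by blast+

section \<open>Explicit flows of the three Killing fields\<close>

lemma flow_X1: "flow X1 = (\<lambda>v (x, y, z). (x + v, y, z + y / 2 * v))"
proof (rule flow_eqI)
  show "is_flow X1 (\<lambda>v (x, y, z). (x + v, y, z + y / 2 * v))"
    by (auto simp: is_flow_def X1_def has_vector_derivative_triple intro!: derivative_eq_intros)
  fix \<phi> v and p :: pt
  assume \<phi>: "is_flow X1 \<phi>"
  obtain x y z where p: "p = (x, y, z)" by (cases p)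
  define f g h where "f w = fst (\<phi> w p)" and "g w = fst (snd (\<phi> w p))" and "h w = snd (snd (\<phi> w p))" for w
  have \<phi>w: "\<phi> w p = (f w, g w, h w)" for w
    by (simp add: f_def g_def h_def)
  have init: "f 0 = x" "g 0 = y" "h 0 = z"
    using is_flowD(1)[OF \<phi>, of p] unfolding \<phi>w unfolding p by simp_all
  have d: "(f has_real_derivative 1) (at w)" "(g has_real_derivative 0) (at w)"
    "(h has_real_derivative g w / 2) (at w)" for w
    using is_flowD(2)[OF \<phi>, of p w] unfolding \<phi>w
    by (simp_all add: X1_def has_vector_derivative_triple)
  \<comment> \<open>The system is triangular: once the second coordinate is known to be constant,
    the third has constant derivative y / 2.\<close>
  have "g w = y" for w
    using affine_if_deriv_const[OF d(2), of w] init by simp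
  then show "\<phi> v p = (case p of (x, y, z) \<Rightarrow> (x + v, y, z + y / 2 * v))"
    using affine_if_deriv_const[OF d(1), of v] affine_if_deriv_const[of h "y / 2" v] d(3) init
    unfolding \<phi>w unfolding p by simp
qed

lemma flow_X3: "flow X3 = (\<lambda>v (x, y, z). (x, y, z + v))"
proof (rule flow_eqI)
  show "is_flow X3 (\<lambda>v (x, y, z). (x, y, z + v))"
    by (auto simp: is_flow_def X3_def has_vector_derivative_triple intro!: derivative_eq_intros)
  fix \<phi> v and p :: pt
  assume \<phi>: "is_flow X3 \<phi>"
  obtain x y z where p: "p = (x, y, z)" by (cases p)
  define f g h where "f w = fst (\<phi> w p)" and "g w = fst (snd (\<phi> w p))" and "h w = snd (snd (\<phi> w p))" for w
  have \<phi>w: "\<phi> w p = (f w, g w, h w)" for w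
    by (simp add: f_def g_def h_def)
  have init: "f 0 = x" "g 0 = y" "h 0 = z"
    using is_flowD(1)[OF \<phi>, of p] unfolding \<phi>w unfolding p by simp_all
  have d: "(f has_real_derivative 0) (at w)" "(g has_real_derivative 0) (at w)"
    "(h has_real_derivative 1) (at w)" for w
    using is_flowD(2)[OF \<phi>, of p w] unfolding \<phi>w
    by (simp_all add: X3_def has_vector_derivative_triple)
  show "\<phi> v p = (case p of (x, y, z) \<Rightarrow> (x, y, z + v))"
    using d[THEN affine_if_deriv_const, of v] init unfolding \<phi>w unfolding p by simp
qed

lemma flow_X43:
  "flow (X43 a) = (\<lambda>v (x, y, z). (x * cos v - y * sin v, x * sin v + y * cos v, z + a * v))"
proof (rule flow_eqI)
  show "is_flow (X43 a) (\<lambda>v (x, y, z). (x * cos v - y * sin v, x * sin v + y * cos v, z + a * v))"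
    by (auto simp: is_flow_def X43_def X4_def X3_def has_vector_derivative_triple
        intro!: derivative_eq_intros)
  fix \<phi> v and p :: pt
  assume \<phi>: "is_flow (X43 a) \<phi>"
  obtain x y z where p: "p = (x, y, z)" by (cases p)
  define f g h where "f w = fst (\<phi> w p)" and "g w = fst (snd (\<phi> w p))" and "h w = snd (snd (\<phi> w p))" for w
  have \<phi>w: "\<phi> w p = (f w, g w, h w)" for w
    by (simp add: f_def g_def h_def)
  have init: "f 0 = x" "g 0 = y" "h 0 = z"
    using is_flowD(1)[OF \<phi>, of p] unfolding \<phi>w unfolding p by simp_all
  have d: "(f has_real_derivative - g w) (at w)" "(g has_real_derivative f w) (at w)"
    "(h has_real_derivative a) (at w)" for w
    using is_flowD(2)[OF \<phi>, of p w] unfolding \<phi>w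
    by (simp_all add: X43_def X4_def X3_def has_vector_derivative_triple)
  \<comment> \<open>Rotating the solution back by the angle \<open>w\<close> makes its horizontal part constant.\<close>
  have "((\<lambda>w. f w * cos w + g w * sin w) has_real_derivative 0) (at w)"
    "((\<lambda>w. g w * cos w - f w * sin w) has_real_derivative 0) (at w)" for w
    by (auto intro!: derivative_eq_intros d)
  from this[THEN affine_if_deriv_const, of v]
  have rot: "f v * cos v + g v * sin v = x" "g v * cos v - f v * sin v = y"
    using init by simp_all
  have "f v = x * cos v - y * sin v" "g v = x * sin v + y * cos v"
    using sin_cos_squared_add[of v] unfolding rot[symmetric] by algebra+
  then show "\<phi> v p = (case p of (x, y, z) \<Rightarrow> (x * cos v - y * sin v, x * sin v + y * cos v, z + a * v))"
    using affine_if_deriv_const[OF d(3), of v] init unfolding \<phi>w unfolding p by simp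
qed

section \<open>Orbit spaces\<close>

lemma flow_cyl: "flow (X43 a) v (cyl p) = cyl (cyl_act a v p)"
  by (cases p) (simp add: flow_X43 cyl_def cyl_act_def sin_add cos_add algebra_simps)

lemma cyl_surj: obtains r \<theta> where "0 \<le> r" "(x, y, z) = cyl (r, \<theta>, z)"
proof -
  have "rcis (cmod (Complex x y)) (Arg (Complex x y)) = Complex x y"
    by (rule rcis_cmod_Arg)
  from arg_cong[OF this, of Re] arg_cong[OF this, of Im]
  show thesis
    by (intro that[of "cmod (Complex x y)" "Arg (Complex x y)"]) (simp_all add: cyl_def)
qed

text \<open>A continuous section makes the map a retraction, hence a quotient map. The sections used
  are the slices x = 0, z = 0 and, in the cylindrical cases, zero angle.\<close>

lemma quotient_map_section:
  assumes "continuous_on C f" "f \<in> C \<rightarrow> B" "continuous_on B s" "s \<in> B \<rightarrow> C" "\<And>b. b \<in> B \<Longrightarrow> f (s b) = b"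
  shows "quotient_map (top_of_set C) (top_of_set B) f"
  using assms
  by (intro retraction_imp_quotient_map) (auto simp: retraction_map_def retraction_maps_def)

lemma orbit_space_X1: "orbit_space X1 id UNIV (flow X1) inv_i UNIV"
  unfolding orbit_space_def
proof (intro conjI)
  show "quotient_map (top_of_set UNIV) (top_of_set UNIV) inv_i"
    by (rule quotient_map_section[where s="\<lambda>(s, t). (0, s, - t)"])
      (auto simp: inv_i_def case_prod_beta intro!: continuous_intros)
  show "\<forall>p\<in>UNIV. \<forall>p'\<in>UNIV. inv_i p = inv_i p' \<longleftrightarrow> (\<exists>v. p' = flow X1 v p)"
  proof (intro ballI)
    fix p p' :: pt
    obtain x y z x' y' z' where p: "p = (x, y, z)" "p' = (x', y', z')" by (cases p, cases p')
    \<comment> \<open>The flow translates x at unit speed, so the time between two points of an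
      orbit is their difference in x.\<close>
    have "inv_i p = inv_i p' \<Longrightarrow> p' = flow X1 (x' - x) p"
      by (auto simp: p inv_i_def flow_X1 field_simps)
    moreover have "p' = flow X1 v p \<Longrightarrow> inv_i p = inv_i p'" for v
      by (auto simp: p inv_i_def flow_X1 field_simps)
    ultimately show "inv_i p = inv_i p' \<longleftrightarrow> (\<exists>v. p' = flow X1 v p)" by blast
  qed
qed auto

lemma orbit_space_X3: "orbit_space X3 id UNIV (flow X3) inv_ii UNIV"
  unfolding orbit_space_def
proof (intro conjI)
  show "quotient_map (top_of_set UNIV) (top_of_set UNIV) inv_ii"
    by (rule quotient_map_section[where s="\<lambda>(s, t). (s, t, 0)"])
      (auto simp: inv_ii_def case_prod_beta intro!: continuous_intros)
  show "\<forall>p\<in>UNIV. \<forall>p'\<in>UNIV. inv_ii p = inv_ii p' \<longleftrightarrow> (\<exists>v. p' = flow X3 v p)"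
  proof (intro ballI)
    fix p p' :: pt
    obtain x y z x' y' z' where p: "p = (x, y, z)" "p' = (x', y', z')" by (cases p, cases p')
    have "inv_ii p = inv_ii p' \<Longrightarrow> p' = flow X3 (z' - z) p"
      by (auto simp: p inv_ii_def flow_X3)
    moreover have "p' = flow X3 v p \<Longrightarrow> inv_ii p = inv_ii p'" for v
      by (auto simp: p inv_ii_def flow_X3)
    ultimately show "inv_ii p = inv_ii p' \<longleftrightarrow> (\<exists>v. p' = flow X3 v p)" by blast
  qed
qed auto

text \<open>On the coordinate domain the group translates the real angle, even at r = 0. The flow
  time is thus always the difference of the angles, and the axis needs no separate
  treatment.\<close>

lemma orbit_space_X43: "orbit_space (X43 a) cyl cyl_dom (cyl_act a) (inv_iii a) half_plane"
  unfolding orbit_space_def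
proof (intro conjI)
  show "cyl ` cyl_dom = UNIV"
  proof (intro set_eqI iffI UNIV_I)
    fix p :: pt
    obtain x y z where p: "p = (x, y, z)" by (cases p)
    obtain r \<theta> where "0 \<le> r" "(x, y, z) = cyl (r, \<theta>, z)" by (rule cyl_surj)
    then show "p \<in> cyl ` cyl_dom" by (auto simp: p cyl_dom_def)
  qed
  show "\<forall>v. \<forall>p\<in>cyl_dom. cyl_act a v p \<in> cyl_dom \<and> cyl (cyl_act a v p) = flow (X43 a) v (cyl p)"
    by (auto simp: flow_cyl) (auto simp: cyl_dom_def cyl_act_def)
  show "quotient_map (top_of_set cyl_dom) (top_of_set half_plane) (inv_iii a)"
    by (rule quotient_map_section[where s="\<lambda>(s, t). (s, 0, t)"])
      (auto simp: inv_iii_def cyl_dom_def half_plane_def case_prod_beta intro!: continuous_intros)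
  show "\<forall>p\<in>cyl_dom. \<forall>p'\<in>cyl_dom. inv_iii a p = inv_iii a p' \<longleftrightarrow> (\<exists>v. p' = cyl_act a v p)"
  proof (intro ballI)
    fix p p' :: pt
    obtain r \<theta> z r' \<theta>' z' where p: "p = (r, \<theta>, z)" "p' = (r', \<theta>', z')" by (cases p, cases p')
    have "inv_iii a p = inv_iii a p' \<Longrightarrow> p' = cyl_act a (\<theta>' - \<theta>) p"
      unfolding p inv_iii_def cyl_act_def split prod.inject right_diff_distrib by linarith
    moreover have "p' = cyl_act a v p \<Longrightarrow> inv_iii a p = inv_iii a p'" for v
      by (simp add: p inv_iii_def cyl_act_def distrib_left)
    ultimately show "inv_iii a p = inv_iii a p' \<longleftrightarrow> (\<exists>v. p' = cyl_act a v p)" by blast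
  qed
qed

text \<open>For a = 0 the second invariant no longer contains the angle, so both invariants are
  continuous functions on the group itself and the orbit space can be taken there. The axis then
  consists of fixed points, which form the boundary of the half plane.\<close>

lemma orbit_space_X4:
  "orbit_space (X43 0) id UNIV (flow (X43 0)) (\<lambda>(x, y, z). (sqrt (x\<^sup>2 + y\<^sup>2), z)) half_plane"
  (is "orbit_space _ _ _ _ ?\<Xi> _")
  unfolding orbit_space_def
proof (intro conjI)
  show "quotient_map (top_of_set UNIV) (top_of_set half_plane) ?\<Xi>"
  proof (rule quotient_map_section[where s="\<lambda>(s, t). (s, 0, t)"])
    show "continuous_on UNIV ?\<Xi>" "continuous_on half_plane (\<lambda>(s, t). (s, 0::real, t))"
      unfolding case_prod_beta
      by (intro continuous_intros)+
  qed (auto simp: half_plane_def)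
  have \<Xi>: "?\<Xi> (cyl (r, \<theta>, z)) = (r, z)" if "0 \<le> r" for r \<theta> z
  proof -
    have "(r * cos \<theta>)\<^sup>2 + (r * sin \<theta>)\<^sup>2 = r\<^sup>2"
      using sin_cos_squared_add[of \<theta>] by algebra
    then show ?thesis using that by (simp add: cyl_def)
  qed
  show "\<forall>p\<in>UNIV. \<forall>p'\<in>UNIV. ?\<Xi> p = ?\<Xi> p' \<longleftrightarrow> (\<exists>v. p' = flow (X43 0) v p)"
  proof (intro ballI)
    fix p p' :: pt
    obtain x y z x' y' z' where xyz: "p = (x, y, z)" "p' = (x', y', z')" by (cases p, cases p')
    obtain r \<theta> where "0 \<le> r" "(x, y, z) = cyl (r, \<theta>, z)" by (rule cyl_surj)
    then have p: "0 \<le> r" "p = cyl (r, \<theta>, z)" by (auto simp: xyz)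
    obtain r' \<theta>' where "0 \<le> r'" "(x', y', z') = cyl (r', \<theta>', z')" by (rule cyl_surj)
    then have p': "0 \<le> r'" "p' = cyl (r', \<theta>', z')" by (auto simp: xyz)
    have "?\<Xi> p = ?\<Xi> p' \<Longrightarrow> p' = flow (X43 0) (\<theta>' - \<theta>) p"
      using \<Xi>[OF p(1)] \<Xi>[OF p'(1)] unfolding p(2) p'(2) flow_cyl by (simp add: cyl_act_def)
    moreover have "?\<Xi> p = ?\<Xi> p'" if "p' = flow (X43 0) v p" for v
      using \<Xi>[OF p(1)] unfolding that unfolding p(2) flow_cyl by (simp add: cyl_act_def)
    ultimately show "?\<Xi> p = ?\<Xi> p' \<longleftrightarrow> (\<exists>v. p' = flow (X43 0) v p)" by blast
  qed
qed auto

section \<open>Parametrizations of invariant surfaces\<close>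

text \<open>The lift is the curve v = 0. Each point of \<open>M\<close> lies over some u and hence
  on the orbit \<psi> u; conversely, \<open>M\<close> contains one point over each u, and invariance
  supplies the rest of its orbit.\<close>

lemma flow_parametrizationI:
  assumes M: "invariant_surface X q C \<Xi> I \<xi>1 \<xi>2 M"
    and imm: "immersion_on (I \<times> UNIV) (\<lambda>(u, v). \<psi> u v)"
    and flow: "\<And>u v w. flow X v (\<psi> u w) = \<psi> u (w + v)"
    and fibre: "\<And>p u. \<lbrakk>p \<in> C; \<Xi> p = (\<xi>1 u, \<xi>2 u)\<rbrakk> \<Longrightarrow> \<exists>w. q p = \<psi> u w"
    and lift: "\<And>u. u \<in> I \<Longrightarrow> \<exists>p\<in>C. q p = \<psi> u 0 \<and> \<Xi> p = (\<xi>1 u, \<xi>2 u)"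
  shows "flow_parametrization X q C \<Xi> I \<xi>1 \<xi>2 M \<psi>"
  unfolding flow_parametrization_def
proof (intro conjI exI[of _ "\<lambda>u. \<psi> u 0"] ballI allI)
  show "immersion_on (I \<times> UNIV) (\<lambda>(u, v). \<psi> u v)" by (rule imm)
  show "\<exists>p\<in>C. q p = \<psi> u 0 \<and> \<Xi> p = (\<xi>1 u, \<xi>2 u)" if "u \<in> I" for u
    using that by (rule lift)
  show "\<psi> u v = flow X v (\<psi> u 0)" for u v
    by (simp add: flow)
  have inv: "flow X v p \<in> M" if "p \<in> M" for v p
    using M that unfolding invariant_surface_def by blast
  show "(\<lambda>(u, v). \<psi> u v) ` (I \<times> UNIV) = M"
  proof (intro equalityI subsetI)
    fix m assume "m \<in> (\<lambda>(u, v). \<psi> u v) ` (I \<times> UNIV)"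
    then obtain u v where u: "u \<in> I" and m: "m = \<psi> u v" by auto
    have "(\<xi>1 u, \<xi>2 u) \<in> \<Xi> ` {p \<in> C. q p \<in> M}"
      using M u unfolding invariant_surface_def by blast
    then obtain p where "p \<in> C" "q p \<in> M" "\<Xi> p = (\<xi>1 u, \<xi>2 u)" by auto
    then obtain w where "\<psi> u w \<in> M" using fibre by metis
    \<comment> \<open>The point of \<open>M\<close> over u sits at flow time w; moving it by v - w
      reaches the required point at time v.\<close>
    from inv[OF this, of "v - w"] show "m \<in> M" by (simp add: flow m)
  next
    fix m assume "m \<in> M"
    then have "m \<in> q ` {p \<in> C. \<Xi> p \<in> (\<lambda>u. (\<xi>1 u, \<xi>2 u)) ` I}"
      using M unfolding invariant_surface_def by blast
    then obtain p u where "p \<in> C" "u \<in> I" "\<Xi> p = (\<xi>1 u, \<xi>2 u)" "m = q p" by auto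
    moreover from this obtain w where "q p = \<psi> u w" using fibre by blast
    ultimately show "m \<in> (\<lambda>(u, v). \<psi> u v) ` (I \<times> UNIV)"
      by (intro image_eqI[of _ _ "(u, w)"]) simp_all
  qed
qed

section \<open>Auxiliary facts for the three concrete parametrizations\<close>

lemma flow_parametrization_image:
  "flow_parametrization X q C \<Xi> I \<xi>1 \<xi>2 M \<psi> \<Longrightarrow> (\<lambda>(u, v). \<psi> u v) ` (I \<times> UNIV) = M"
  by (simp add: flow_parametrization_def)

lemma has_derivative_fst_compose:
  fixes f :: "real \<Rightarrow> real"
  assumes "(f has_real_derivative d) (at u)"
  shows "((\<lambda>p. f (fst p)) has_derivative (\<lambda>h. fst h * d)) (at (u, v))"
  using has_derivative_compose[OF has_derivative_fst[OF has_derivative_ident], of f "(*) d" "(u, v)" UNIV] assms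
  by (simp add: has_field_derivative_def mult.commute)

lemma continuous_on_fst_compose:
  assumes "continuous_on I f"
  shows "continuous_on (I \<times> S) (\<lambda>p. f (fst p))"
  by (rule continuous_on_compose2[OF assms continuous_on_fst[OF continuous_on_id]]) auto

text \<open>The square root only yields the absolute value of \<open>y\<close>, and \<epsilon>
  restores its sign. At y = 0 both sides vanish for either choice of \<epsilon>.\<close>

lemma branch_sqrt:
  fixes x y q \<epsilon> :: real
  assumes "x\<^sup>2 + y\<^sup>2 / q = 1" "0 < q" "\<epsilon> \<in> {1, -1}" "0 \<le> \<epsilon> * y"
  shows "\<epsilon> * sqrt (1 - x\<^sup>2) = y / sqrt q"
proof -
  have "1 - x\<^sup>2 = y\<^sup>2 / q" using assms(1) by simp
  then have "sqrt (1 - x\<^sup>2) = \<bar>y\<bar> / sqrt q" by (simp add: real_sqrt_divide)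
  then show ?thesis using assms(3,4) by auto
qed

lemma profile_curveD:
  assumes "profile_curve Q R I \<xi>1 \<xi>2"
  shows "open I" "is_interval I"
    and "\<And>u. u \<in> I \<Longrightarrow> (\<xi>1 has_real_derivative deriv \<xi>1 u) (at u)"
    and "\<And>u. u \<in> I \<Longrightarrow> (\<xi>2 has_real_derivative deriv \<xi>2 u) (at u)"
    and "continuous_on I \<xi>1" "continuous_on I \<xi>2" "continuous_on I (deriv \<xi>1)" "continuous_on I (deriv \<xi>2)"
    and "\<And>u. u \<in> I \<Longrightarrow> (\<xi>1 u, \<xi>2 u) \<in> R"
    and "\<And>u. u \<in> I \<Longrightarrow> Q (\<xi>1 u, \<xi>2 u) (deriv \<xi>1 u, deriv \<xi>2 u) = 1"
  using assms C1_differentiable_on_derivD[of \<xi>1 I] C1_differentiable_on_derivD[of \<xi>2 I]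
  by (auto simp: profile_curve_def intro: C1_differentiable_imp_continuous_on)

lemma clear_denominator:
  fixes x y q :: real
  assumes "x + y / q = 1" "0 < q"
  shows "x * q + y = q"
  using assms by (simp add: field_simps)

text \<open>\<psi> is the flow of the lift (0, \<xi>1, - \<xi>2) in the slice x = 0. The form y/2 dx
  - x/2 dy + dz takes the values - \<xi>2' on \<psi>_u and \<xi>1 on \<psi>_v, which gives F = -
  \<xi>1 \<xi>2' and G = 1 + \<xi>1^2.\<close>

lemma invariant_surface_X1:
  assumes u0: "u0 \<in> I" and \<theta>: "0 < \<theta>" "\<theta> < pi" and \<epsilon>: "branch_sign I \<xi>2 \<epsilon>"
    and prof: "profile_curve quot_i UNIV I \<xi>1 \<xi>2"
    and M: "invariant_surface X1 id UNIV inv_i I \<xi>1 \<xi>2 M"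
  shows "flow_parametrization X1 id UNIV inv_i I \<xi>1 \<xi>2 M (\<lambda>u v. (v, \<xi>1 u, \<xi>1 u / 2 * v - \<xi>2 u))" (is ?flow)
    and "loxodromes_parametrized X1 M \<theta> I (\<lambda>u v. (v, \<xi>1 u, \<xi>1 u / 2 * v - \<xi>2 u))
      (\<lambda>\<sigma> (u::real). LBINT t=u0..u.
        (\<xi>1 t * (\<epsilon> t * sqrt (1 - (deriv \<xi>1 t)\<^sup>2)) + \<sigma> * cot \<theta>) / sqrt (1 + (\<xi>1 t)\<^sup>2))"
      (is "loxodromes_parametrized _ _ _ _ ?\<psi> ?v")
proof -
  note p = profile_curveD[OF prof]
  have pos: "0 < 1 + x\<^sup>2" for x :: real
    by (simp add: add_pos_nonneg)
  have unit: "(deriv \<xi>1 u)\<^sup>2 + (deriv \<xi>2 u)\<^sup>2 / (1 + (\<xi>1 u)\<^sup>2) = 1" if "u \<in> I" for u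
    using p(10)[OF that] by (simp add: quot_i_def)
  interpret invariant_parametrization X1 I ?\<psi> "\<lambda>u v. (0, deriv \<xi>1 u, deriv \<xi>1 u / 2 * v - deriv \<xi>2 u)"
    "\<lambda>u v. (1, 0, \<xi>1 u / 2)" "\<lambda>u. (deriv \<xi>1 u)\<^sup>2 + (deriv \<xi>2 u)\<^sup>2" "\<lambda>u. - (\<xi>1 u * deriv \<xi>2 u)" "\<lambda>u. 1 + (\<xi>1 u)\<^sup>2"
  proof
    fix u v assume u: "u \<in> I"
    note d = has_derivative_fst_compose[OF p(3)[OF u], of v] has_derivative_fst_compose[OF p(4)[OF u], of v]
    show "((\<lambda>(u, v). ?\<psi> u v) has_derivative (\<lambda>(h, k). h *\<^sub>R (0, deriv \<xi>1 u, deriv \<xi>1 u / 2 * v - deriv \<xi>2 u)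
        + k *\<^sub>R (1, 0, \<xi>1 u / 2))) (at (u, v))"
      unfolding case_prod_beta
      by (auto intro!: derivative_eq_intros d simp: fun_eq_iff field_simps)
    have "(deriv \<xi>1 u)\<^sup>2 * (1 + (\<xi>1 u)\<^sup>2) + (deriv \<xi>2 u)\<^sup>2 = 1 + (\<xi>1 u)\<^sup>2"
      by (rule clear_denominator[OF unit[OF u] pos])
    then show "((deriv \<xi>1 u)\<^sup>2 + (deriv \<xi>2 u)\<^sup>2) * (1 + (\<xi>1 u)\<^sup>2) - (- (\<xi>1 u * deriv \<xi>2 u))\<^sup>2 = 1 + (\<xi>1 u)\<^sup>2"
      by (simp add: algebra_simps power_mult_distrib)
  next
    show "continuous_on (I \<times> UNIV) (\<lambda>(u, v). (0, deriv \<xi>1 u, deriv \<xi>1 u / 2 * v - deriv \<xi>2 u))"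
      "continuous_on (I \<times> UNIV) (\<lambda>(u, v). (1, 0, \<xi>1 u / 2))"
      unfolding case_prod_beta
      by (intro continuous_intros continuous_on_fst_compose p; simp)+
  qed (use p pos in \<open>auto simp: X1_def heis_def power2_eq_square field_simps intro!: continuous_intros\<close>)
  show ?flow
  proof (rule flow_parametrizationI[OF M immersion])
    show "flow X1 v (?\<psi> u w) = ?\<psi> u (w + v)" for u v w
      by (simp add: flow_X1 distrib_left)
    show "\<exists>w. id p = ?\<psi> u w" if "inv_i p = (\<xi>1 u, \<xi>2 u)" for p u
      using that by (cases p) (auto simp: inv_i_def mult.commute)
  qed (auto simp: inv_i_def)
  show "loxodromes_parametrized X1 M \<theta> I ?\<psi> ?v"
  proof (rule loxodromes[OF u0 \<theta> flow_parametrization_image[OF \<open>?flow\<close>]])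
    fix \<sigma> u :: real assume "u \<in> I"
    show "(?v \<sigma> has_real_derivative slope \<theta> \<sigma> u) (at u)"
    proof (rule interval_integral_has_real_derivative[OF I u0 \<open>u \<in> I\<close> continuous_on_slope])
      fix t assume t: "t \<in> I"
      define g where "g = sqrt (1 + (\<xi>1 t)\<^sup>2)"
      have g: "0 < g" "1 + (\<xi>1 t)\<^sup>2 = g\<^sup>2"
        using pos[of "\<xi>1 t"] by (auto simp: g_def)
      \<comment> \<open>Hence - F / G = \<xi>1 \<xi>2' / g^2 is \<xi>1 times the signed root,
        divided by g, as in the integrand.\<close>
      have "\<epsilon> t * sqrt (1 - (deriv \<xi>1 t)\<^sup>2) = deriv \<xi>2 t / g"
        unfolding g_def using \<epsilon> t by (intro branch_sqrt unit pos) (auto simp: branch_sign_def)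
      then show "(\<xi>1 t * (\<epsilon> t * sqrt (1 - (deriv \<xi>1 t)\<^sup>2)) + \<sigma> * cot \<theta>) / sqrt (1 + (\<xi>1 t)\<^sup>2) = slope \<theta> \<sigma> t"
        unfolding slope_def g_def[symmetric] unfolding g(2)
        using g(1) by (simp add: field_simps power2_eq_square)
    qed
  qed
qed

text \<open>Here G = 1 and - F = (\<xi>1 \<xi>2' - \<xi>2 \<xi>1') / 2, which equals \<xi>1 \<xi>2'
  - (\<xi>1 \<xi>2)' / 2. Integrating the last term gives the boundary contribution outside the
  integral. Writing \<xi>2 there as \<xi>2 u0 plus the integral of \<xi>2' produces the final
  correction term, normalized so that v vanishes at u0.\<close>

lemma invariant_surface_X3:
  assumes u0: "u0 \<in> I" and \<theta>: "0 < \<theta>" "\<theta> < pi" and \<epsilon>: "branch_sign I \<xi>2 \<epsilon>"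
    and prof: "profile_curve quot_ii UNIV I \<xi>1 \<xi>2"
    and M: "invariant_surface X3 id UNIV inv_ii I \<xi>1 \<xi>2 M"
  defines "v \<equiv> \<lambda>\<sigma> u. - (\<xi>1 u / 2) * (LBINT t=u0..u. \<epsilon> t * sqrt (1 - (deriv \<xi>1 t)\<^sup>2))
                    + (LBINT t=u0..u. \<xi>1 t * (\<epsilon> t * sqrt (1 - (deriv \<xi>1 t)\<^sup>2)))
                    + \<sigma> * cot \<theta> * (u - u0)
                    - \<xi>2 u0 / 2 * (\<xi>1 u - \<xi>1 u0)"
  shows "flow_parametrization X3 id UNIV inv_ii I \<xi>1 \<xi>2 M (\<lambda>u v. (\<xi>1 u, \<xi>2 u, v))" (is ?flow)
    and "loxodromes_parametrized X3 M \<theta> I (\<lambda>u v. (\<xi>1 u, \<xi>2 u, v)) v"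
      (is "loxodromes_parametrized _ _ _ _ ?\<psi> _")
    and "\<sigma> \<in> {1, -1} \<Longrightarrow> general_helix X3 I (\<lambda>u. (\<xi>1 u, \<xi>2 u, v \<sigma> u))"
proof -
  note p = profile_curveD[OF prof]
  have unit: "(deriv \<xi>1 u)\<^sup>2 + (deriv \<xi>2 u)\<^sup>2 = 1" if "u \<in> I" for u
    using p(10)[OF that] by (simp add: quot_ii_def)
  let ?F = "\<lambda>u. (\<xi>2 u * deriv \<xi>1 u - \<xi>1 u * deriv \<xi>2 u) / 2"
  interpret invariant_parametrization X3 I ?\<psi> "\<lambda>u v. (deriv \<xi>1 u, deriv \<xi>2 u, 0)"
    "\<lambda>u v. (0, 0, 1)" "\<lambda>u. 1 + (?F u)\<^sup>2" ?F "\<lambda>u. 1"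
  proof
    fix u v assume u: "u \<in> I"
    note d = has_derivative_fst_compose[OF p(3)[OF u], of v] has_derivative_fst_compose[OF p(4)[OF u], of v]
    show "((\<lambda>(u, v). ?\<psi> u v) has_derivative (\<lambda>(h, k). h *\<^sub>R (deriv \<xi>1 u, deriv \<xi>2 u, 0)
        + k *\<^sub>R (0, 0, 1))) (at (u, v))"
      unfolding case_prod_beta
      by (auto intro!: derivative_eq_intros d simp: fun_eq_iff)
    show "heis (\<xi>1 u, \<xi>2 u, v) (deriv \<xi>1 u, deriv \<xi>2 u, 0) (deriv \<xi>1 u, deriv \<xi>2 u, 0) = 1 + (?F u)\<^sup>2"
      using unit[OF u] by (simp add: heis_def power2_eq_square diff_divide_distrib)
    show "heis (\<xi>1 u, \<xi>2 u, v) (deriv \<xi>1 u, deriv \<xi>2 u, 0) (0, 0, 1) = ?F u"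
      by (simp add: heis_def diff_divide_distrib)
  next
    show "continuous_on (I \<times> UNIV) (\<lambda>(u, v). (deriv \<xi>1 u, deriv \<xi>2 u, 0::real))"
      unfolding case_prod_beta
      by (intro continuous_intros continuous_on_fst_compose p; simp)+
    show "continuous_on I ?F"
      by (intro continuous_intros p) auto
  qed (use p in \<open>auto simp: X3_def heis_def\<close>)
  show ?flow
  proof (rule flow_parametrizationI[OF M immersion])
    show "\<exists>w. id p = ?\<psi> u w" if "inv_ii p = (\<xi>1 u, \<xi>2 u)" for p u
      using that by (cases p) (auto simp: inv_ii_def)
  qed (auto simp: flow_X3 inv_ii_def)
  have root: "\<epsilon> t * sqrt (1 - (deriv \<xi>1 t)\<^sup>2) = deriv \<xi>2 t" if "t \<in> I" for t
    using branch_sqrt[of "deriv \<xi>1 t" "deriv \<xi>2 t" 1 "\<epsilon> t"] unit[OF that] \<epsilon> that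
    by (simp add: branch_sign_def)
  have dv: "(v \<sigma> has_real_derivative slope \<theta> \<sigma> u) (at u)" if u: "u \<in> I" for \<sigma> u
  proof -
    let ?J = "\<lambda>u. LBINT t=u0..u. \<epsilon> t * sqrt (1 - (deriv \<xi>1 t)\<^sup>2)"
    let ?K = "\<lambda>u. LBINT t=u0..u. \<xi>1 t * (\<epsilon> t * sqrt (1 - (deriv \<xi>1 t)\<^sup>2))"
    have dJ: "(?J has_real_derivative deriv \<xi>2 x) (at x)" if "x \<in> I" for x
      by (rule interval_integral_has_real_derivative[OF I u0 that p(8) root])
    have dK: "(?K has_real_derivative \<xi>1 u * deriv \<xi>2 u) (at u)"
      by (rule interval_integral_has_real_derivative[OF I u0 u]) (auto intro!: continuous_intros p simp: root)
    have "((\<lambda>x. \<xi>2 x - ?J x) has_real_derivative 0) (at x)" if "x \<in> I" for x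
      using DERIV_diff[OF p(4)[OF that] dJ[OF that]] by simp
    then obtain c where "\<forall>x\<in>I. \<xi>2 x - ?J x = c"
      using constant_on_interval[OF I(2), of "\<lambda>x. \<xi>2 x - ?J x"] by blast
    \<comment> \<open>The product rule leaves the integral itself in the derivative of v, so its
      value is required and not only its derivative. The term with \<xi>2 u0 cancels against the
      correction term of v.\<close>
    from bspec[OF this u] bspec[OF this u0] have J: "?J u = \<xi>2 u - \<xi>2 u0"
      by simp
    have "(v \<sigma> has_real_derivative - (deriv \<xi>1 u / 2) * ?J u - \<xi>1 u / 2 * deriv \<xi>2 u
        + \<xi>1 u * deriv \<xi>2 u + \<sigma> * cot \<theta> - \<xi>2 u0 / 2 * deriv \<xi>1 u) (at u)"
      unfolding v_def by (auto intro!: derivative_eq_intros dJ dK p(3) u simp: add_divide_distrib)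
    also have "- (deriv \<xi>1 u / 2) * ?J u - \<xi>1 u / 2 * deriv \<xi>2 u
        + \<xi>1 u * deriv \<xi>2 u + \<sigma> * cot \<theta> - \<xi>2 u0 / 2 * deriv \<xi>1 u = slope \<theta> \<sigma> u"
      unfolding J slope_def by (simp add: field_simps)
    finally show ?thesis .
  qed
  show "loxodromes_parametrized X3 M \<theta> I ?\<psi> v"
    by (rule loxodromes[OF u0 \<theta> flow_parametrization_image[OF \<open>?flow\<close>] dv])
  show "general_helix X3 I (\<lambda>u. (\<xi>1 u, \<xi>2 u, v \<sigma> u))" if "\<sigma> \<in> {1, -1}"
    by (rule general_helix_slope[OF \<theta> that dv])
qed

text \<open>The form y/2 dx - x/2 dy + dz takes the values \<xi>2' on \<psi>_u and a - \<xi>1^2 / 2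
  on \<psi>_v, while the horizontal parts of the two vectors are orthogonal. So F is the product of
  these values, and the rotation adds \<xi>1^2 to G. Regularity, \<xi>1 > 0, makes G
  positive.\<close>

lemma invariant_surface_X43:
  assumes u0: "u0 \<in> I" and \<theta>: "0 < \<theta>" "\<theta> < pi" and \<epsilon>: "branch_sign I \<xi>2 \<epsilon>"
    and prof: "profile_curve (quot_iii a) open_half_plane I \<xi>1 \<xi>2"
    and M: "invariant_surface (X43 a) cyl cyl_dom (inv_iii a) I \<xi>1 \<xi>2 M"
  shows "flow_parametrization (X43 a) cyl cyl_dom (inv_iii a) I \<xi>1 \<xi>2 M
      (\<lambda>u v. (\<xi>1 u * cos v, \<xi>1 u * sin v, \<xi>2 u + a * v))" (is ?flow)
    and "loxodromes_parametrized (X43 a) M \<theta> I (\<lambda>u v. (\<xi>1 u * cos v, \<xi>1 u * sin v, \<xi>2 u + a * v))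
      (\<lambda>\<sigma> (u::real). LBINT t=u0..u.
        (((\<xi>1 t)\<^sup>2 - 2 * a) * (\<epsilon> t * sqrt (1 - (deriv \<xi>1 t)\<^sup>2)) + \<sigma> * (2 * cot \<theta> * \<xi>1 t))
          / (\<xi>1 t * sqrt (4 * (\<xi>1 t)\<^sup>2 + ((\<xi>1 t)\<^sup>2 - 2 * a)\<^sup>2)))"
      (is "loxodromes_parametrized _ _ _ _ ?\<psi> ?v")
proof -
  note p = profile_curveD[OF prof]
  have r: "0 < \<xi>1 u" if "u \<in> I" for u
    using p(9)[OF that] by (simp add: open_half_plane_def)
  let ?G = "\<lambda>u. (\<xi>1 u)\<^sup>2 + (a - (\<xi>1 u)\<^sup>2 / 2)\<^sup>2"
  \<comment> \<open>The denominator of the quotient metric is 4 G; accordingly the root in the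
    integrand is 2 sqrt G, which accounts for the factor 2 before cot \<theta>.\<close>
  have G4: "4 * (\<xi>1 u)\<^sup>2 + ((\<xi>1 u)\<^sup>2 - 2 * a)\<^sup>2 = 4 * ?G u" for u
    by (simp add: power2_eq_square field_simps)
  have pos: "0 < ?G u" if "u \<in> I" for u
    using r[OF that] by (simp add: add_pos_nonneg)
  have unit: "(deriv \<xi>1 u)\<^sup>2 + (deriv \<xi>2 u)\<^sup>2 / (?G u / (\<xi>1 u)\<^sup>2) = 1" if "u \<in> I" for u
  proof -
    have quotient: "4 * s * y / (4 * g) = y / (g / s)" for s y g :: real by simp
    show ?thesis
      using p(10)[OF that] unfolding quot_iii_def split G4 quotient .
  qed
  interpret invariant_parametrization "X43 a" I ?\<psi> "\<lambda>u v. (deriv \<xi>1 u * cos v, deriv \<xi>1 u * sin v, deriv \<xi>2 u)"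
    "\<lambda>u v. (- (\<xi>1 u * sin v), \<xi>1 u * cos v, a)" "\<lambda>u. (deriv \<xi>1 u)\<^sup>2 + (deriv \<xi>2 u)\<^sup>2"
    "\<lambda>u. deriv \<xi>2 u * (a - (\<xi>1 u)\<^sup>2 / 2)" ?G
  proof
    fix u v assume u: "u \<in> I"
    note d = has_derivative_fst_compose[OF p(3)[OF u], of v] has_derivative_fst_compose[OF p(4)[OF u], of v]
    show "((\<lambda>(u, v). ?\<psi> u v) has_derivative (\<lambda>(h, k).
        h *\<^sub>R (deriv \<xi>1 u * cos v, deriv \<xi>1 u * sin v, deriv \<xi>2 u)
        + k *\<^sub>R (- (\<xi>1 u * sin v), \<xi>1 u * cos v, a))) (at (u, v))"
      unfolding case_prod_beta
      by (auto intro!: derivative_eq_intros d simp: fun_eq_iff algebra_simps)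
    \<comment> \<open>Naming sine and cosine makes the remaining identities polynomial, with C^2 +
      S^2 = 1 as the only trigonometric relation.\<close>
    define C S where "C = cos v" and "S = sin v"
    note CS = C_def[symmetric] S_def[symmetric]
    have one: "C * C + S * S = 1"
      using sin_cos_squared_add[of v] by (simp add: C_def S_def power2_eq_square)
    define D where "D = deriv \<xi>1 u"
    have A: "\<xi>1 u * S / 2 * (D * C) - \<xi>1 u * C / 2 * (D * S) + deriv \<xi>2 u = deriv \<xi>2 u"
      by simp
    have "\<xi>1 u * S / 2 * - (\<xi>1 u * S) - \<xi>1 u * C / 2 * (\<xi>1 u * C) + a
        = a - (C * C + S * S) * (\<xi>1 u)\<^sup>2 / 2"
      by (simp add: power2_eq_square field_simps)
    then have B: "\<xi>1 u * S / 2 * - (\<xi>1 u * S) - \<xi>1 u * C / 2 * (\<xi>1 u * C) + a = a - (\<xi>1 u)\<^sup>2 / 2"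
      by (simp add: one)
    show "heis (?\<psi> u v) (deriv \<xi>1 u * cos v, deriv \<xi>1 u * sin v, deriv \<xi>2 u)
        (deriv \<xi>1 u * cos v, deriv \<xi>1 u * sin v, deriv \<xi>2 u) = (deriv \<xi>1 u)\<^sup>2 + (deriv \<xi>2 u)\<^sup>2"
      unfolding heis_def split CS D_def[symmetric] A using one by algebra
    show "heis (?\<psi> u v) (deriv \<xi>1 u * cos v, deriv \<xi>1 u * sin v, deriv \<xi>2 u)
        (- (\<xi>1 u * sin v), \<xi>1 u * cos v, a) = deriv \<xi>2 u * (a - (\<xi>1 u)\<^sup>2 / 2)"
      unfolding heis_def split CS D_def[symmetric] A B by simp
    show "heis (?\<psi> u v) (- (\<xi>1 u * sin v), \<xi>1 u * cos v, a) (- (\<xi>1 u * sin v), \<xi>1 u * cos v, a) = ?G u"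
      unfolding heis_def split CS B using one by algebra
    have "(deriv \<xi>1 u)\<^sup>2 * ?G u + (deriv \<xi>2 u)\<^sup>2 * (\<xi>1 u)\<^sup>2 = ?G u"
      using unit[OF u] by (intro clear_denominator pos u) simp
    then show "((deriv \<xi>1 u)\<^sup>2 + (deriv \<xi>2 u)\<^sup>2) * ?G u - (deriv \<xi>2 u * (a - (\<xi>1 u)\<^sup>2 / 2))\<^sup>2 = ?G u"
      by (simp add: distrib_left distrib_right power_mult_distrib)
  next
    show "continuous_on (I \<times> UNIV) (\<lambda>(u, v). (deriv \<xi>1 u * cos v, deriv \<xi>1 u * sin v, deriv \<xi>2 u))"
      "continuous_on (I \<times> UNIV) (\<lambda>(u, v). (- (\<xi>1 u * sin v), \<xi>1 u * cos v, a))"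
      unfolding case_prod_beta
      by (intro continuous_intros continuous_on_fst_compose p; simp)+
    show "continuous_on I (\<lambda>u. deriv \<xi>2 u * (a - (\<xi>1 u)\<^sup>2 / 2))" "continuous_on I ?G"
      by (intro continuous_intros p; simp)+
  qed (use p pos in \<open>simp_all add: X43_def X4_def X3_def\<close>)
  show ?flow
  proof (rule flow_parametrizationI[OF M immersion])
    show "flow (X43 a) v (?\<psi> u w) = ?\<psi> u (w + v)" for u v w
      by (simp add: flow_X43 sin_add cos_add algebra_simps)
    show "\<exists>w. cyl p = ?\<psi> u w" if "inv_iii a p = (\<xi>1 u, \<xi>2 u)" for p u
      using that by (cases p) (auto simp: inv_iii_def cyl_def)
    show "\<exists>p\<in>cyl_dom. cyl p = ?\<psi> u 0 \<and> inv_iii a p = (\<xi>1 u, \<xi>2 u)" if "u \<in> I" for u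
      using r[OF that] by (intro bexI[of _ "(\<xi>1 u, 0, \<xi>2 u)"]) (auto simp: inv_iii_def cyl_def cyl_dom_def)
  qed
  show "loxodromes_parametrized (X43 a) M \<theta> I ?\<psi> ?v"
  proof (rule loxodromes[OF u0 \<theta> flow_parametrization_image[OF \<open>?flow\<close>]])
    fix \<sigma> u :: real assume "u \<in> I"
    show "(?v \<sigma> has_real_derivative slope \<theta> \<sigma> u) (at u)"
    proof (rule interval_integral_has_real_derivative[OF I u0 \<open>u \<in> I\<close> continuous_on_slope])
      fix t assume t: "t \<in> I"
      define g where "g = sqrt (?G t)"
      have g: "0 < g" "?G t = g\<^sup>2"
        using pos[OF t] by (auto simp: g_def)
      have "\<epsilon> t * sqrt (1 - (deriv \<xi>1 t)\<^sup>2) = deriv \<xi>2 t / sqrt (?G t / (\<xi>1 t)\<^sup>2)"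
        using \<epsilon> t pos[OF t] r[OF t] by (intro branch_sqrt unit) (auto simp: branch_sign_def)
      also have "sqrt (?G t / (\<xi>1 t)\<^sup>2) = g / \<xi>1 t"
        using r[OF t] by (simp add: real_sqrt_divide g_def)
      finally have root: "\<epsilon> t * sqrt (1 - (deriv \<xi>1 t)\<^sup>2) = deriv \<xi>2 t * \<xi>1 t / g"
        by simp
      have g2: "sqrt (4 * g\<^sup>2) = 2 * g"
        using g(1) by (simp add: real_sqrt_mult)
      show "(((\<xi>1 t)\<^sup>2 - 2 * a) * (\<epsilon> t * sqrt (1 - (deriv \<xi>1 t)\<^sup>2)) + \<sigma> * (2 * cot \<theta> * \<xi>1 t))
          / (\<xi>1 t * sqrt (4 * (\<xi>1 t)\<^sup>2 + ((\<xi>1 t)\<^sup>2 - 2 * a)\<^sup>2)) = slope \<theta> \<sigma> t"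
        unfolding slope_def root G4 g(2) g2 using g(1) r[OF t]
        by (simp add: field_simps power2_eq_square)
    qed
  qed
qed

theorem theorem5p3:
  fixes \<xi>1 \<xi>2 \<epsilon> :: "real \<Rightarrow> real" and I :: "real set" and M :: "(real \<times> real \<times> real) set"
    and u0 \<theta>0 a :: real
  assumes "u0 \<in> I" and "0 \<le> \<theta>0" and "\<theta>0 < pi" and "\<theta>0 \<noteq> 0"
    and "branch_sign I \<xi>2 \<epsilon>"
  shows
    "(orbit_space X1 id UNIV (flow X1) inv_i UNIV \<and>
      (profile_curve quot_i UNIV I \<xi>1 \<xi>2 \<and> invariant_surface X1 id UNIV inv_i I \<xi>1 \<xi>2 M \<longrightarrow>
        (let \<psi> = (\<lambda>u v. (v, \<xi>1 u, \<xi>1 u / 2 * v - \<xi>2 u));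
             v = (\<lambda>\<sigma> (u::real). LBINT t=u0..u.
                    (\<xi>1 t * (\<epsilon> t * sqrt (1 - (deriv \<xi>1 t)\<^sup>2)) + \<sigma> * cot \<theta>0)
                      / sqrt (1 + (\<xi>1 t)\<^sup>2))
         in flow_parametrization X1 id UNIV inv_i I \<xi>1 \<xi>2 M \<psi> \<and>
            loxodromes_parametrized X1 M \<theta>0 I \<psi> v)))
     \<and>
     (orbit_space X3 id UNIV (flow X3) inv_ii UNIV \<and>
      (profile_curve quot_ii UNIV I \<xi>1 \<xi>2 \<and> invariant_surface X3 id UNIV inv_ii I \<xi>1 \<xi>2 M \<longrightarrow>
        (let \<psi> = (\<lambda>u v. (\<xi>1 u, \<xi>2 u, v));
             v = (\<lambda>\<sigma> u. - (\<xi>1 u / 2) * (LBINT t=u0..u. \<epsilon> t * sqrt (1 - (deriv \<xi>1 t)\<^sup>2))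
                    + (LBINT t=u0..u. \<xi>1 t * (\<epsilon> t * sqrt (1 - (deriv \<xi>1 t)\<^sup>2)))
                    + \<sigma> * cot \<theta>0 * (u - u0)
                    - \<xi>2 u0 / 2 * (\<xi>1 u - \<xi>1 u0))
         in flow_parametrization X3 id UNIV inv_ii I \<xi>1 \<xi>2 M \<psi> \<and>
            loxodromes_parametrized X3 M \<theta>0 I \<psi> v \<and>
            (\<forall>\<sigma>\<in>{1, -1}. general_helix X3 I (\<lambda>u. \<psi> u (v \<sigma> u))))))
     \<and>
     (orbit_space (X43 a) cyl cyl_dom (cyl_act a) (inv_iii a) half_plane \<and>
      (a = 0 \<longrightarrow> orbit_space (X43 a) id UNIV (flow (X43 a)) (\<lambda>(x, y, z). (sqrt (x\<^sup>2 + y\<^sup>2), z)) half_plane) \<and>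
      (profile_curve (quot_iii a) open_half_plane I \<xi>1 \<xi>2 \<and>
       invariant_surface (X43 a) cyl cyl_dom (inv_iii a) I \<xi>1 \<xi>2 M \<longrightarrow>
        (let \<psi> = (\<lambda>u v. (\<xi>1 u * cos v, \<xi>1 u * sin v, \<xi>2 u + a * v));
             v = (\<lambda>\<sigma> (u::real). LBINT t=u0..u.
                    (((\<xi>1 t)\<^sup>2 - 2 * a) * (\<epsilon> t * sqrt (1 - (deriv \<xi>1 t)\<^sup>2)) + \<sigma> * (2 * cot \<theta>0 * \<xi>1 t))
                      / (\<xi>1 t * sqrt (4 * (\<xi>1 t)\<^sup>2 + ((\<xi>1 t)\<^sup>2 - 2 * a)\<^sup>2)))
         in flow_parametrization (X43 a) cyl cyl_dom (inv_iii a) I \<xi>1 \<xi>2 M \<psi> \<and>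
            loxodromes_parametrized (X43 a) M \<theta>0 I \<psi> v)))"
proof -
  have \<theta>: "0 < \<theta>0" "\<theta>0 < pi"
    using assms by auto
  note surface = assms(1) \<theta> assms(5)
  show ?thesis
    unfolding Let_def
    using orbit_space_X1 orbit_space_X3 orbit_space_X43[of a] orbit_space_X4
      invariant_surface_X1[OF surface] invariant_surface_X3[OF surface] invariant_surface_X43[OF surface, of a]
    by (intro conjI impI ballI) (blast | simp)+
qed

end
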